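(* Let $q>0$, $q\neq 1$, and consider the lattice $x(s)=\mathfrak{c}_1 q^{-s}+\mathfrak{c}_2 q^{s}+\mathfrak{c}_3$ with $\mathfrak{c}_1,\mathfrak{c}_2,\mathfrak{c}_3\in\mathbb{C}$, $(\mathfrak{c}_1,\mathfrak{c}_2)\neq(0,0)$. Let ${\bf u}\in\mathcal{P}^*\setminus\{{\bf 0}\}$ and suppose that there exists $(\phi,\psi)\in\mathcal{P}_2\times\mathcal{P}_1\setminus\{(0,0)\}$ such that $$\mathbf{D}_x(\phi{\bf u})=\mathbf{S}_x(\psi{\bf u}).$$ Write $\phi(z)=az^2+bz+c$ and $\psi(z)=dz+e$ with $a,b,c,d,e\in\mathbb{C}$, and set, for $n=0,1,\ldots$, $$d_n:=a\gamma_n+d\alpha_n,\qquad e_n:=\phi'(\mathfrak{c}_3)\gamma_n+\psi(\mathfrak{c}_3)\alpha_n,$$ $$\psi^{[n]}(z)=\big(a\gamma_{2n}+d\alpha_{2n}\big)(z-\mathfrak{c}_3)+\phi'(\mathfrak{c}_3)\gamma_n+\psi(\mathfrak{c}_3)\alpha_n,$$ $$\phi^{[n]}(z)=\big(d(\alpha^2-1)\gamma_{2n}+a\alpha_{2n}\big)\big((z-\mathfrak{c}_3)^2-2\mathfrak{c}_1\mathfrak{c}_2\big)+\big(\phi'(\mathfrak{c}_3)\alpha_n+\psi(\mathfrak{c}_3)(\alpha^2-1)\gamma_n\big)(z-\mathfrak{c}_3)+\phi(\mathfrak{c}_3)+2a\mathfrak{c}_1\mathfrak{c}_2.$$ Then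 ${\bf u}$ is regular if and only if $(\phi,\psi)$ is an $x$-admissible pair and $\psi^{[n]}\nmid\phi^{[n]}$ for each $n=0,1,\ldots$; that is to say, ${\bf u}$ is regular if and only if $$d_n\neq0\quad\text{and}\quad \phi^{[n]}\left(\mathfrak{c}_3-\frac{e_n}{d_{2n}}\right)\neq0\qquad\text{for all } n=0,1,\ldots.$$ Under such conditions, the monic OPS $(P_n)_{n\geq0}$ with respect to ${\bf u}$ satisfies $$P_{n+1}(z)=(z-B_n)P_n(z)-C_nP_{n-1}(z)\quad(n=0,1,\ldots),\qquad P_{-1}(z)=0,$$ where, for $n=0,1,\ldots$, $$B_n=\mathfrak{c}_3+\frac{\gamma_n e_{n-1}}{d_{2n-2}}-\frac{\gamma_{n+1}e_n}{d_{2n}},\qquad C_{n+1}=-\frac{\gamma_{n+1}d_{n-1}}{d_{2n-1}d_{2n+1}}\,\phi^{[n]}\left(\mathfrak{c}_3-\frac{e_n}{d_{2n}}\right).$$ (For $n=0$, the term $\gamma_0e_{-1}/d_{-2}$ is read as $0$, and the quotient $d_{n-1}/d_{2n-1}$ is read as $1$.) Moreover, the following functional Rodrigues formula holds: $$P_n{\bf u}=k_n\,\mathbf{D}_x^n{\bf u}^{[n]},\qquad k_n:=(-\alpha)^{-n}\prod_{j=1}^n d_{n+j-2}^{-1}\qquad(n=0,1,\ldots).$$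
   Context: $\mathcal{P}$ is the vector space of complex polynomials in $z$, $\mathcal{P}_n$ the subspace of polynomials of degree at most $n$, $\mathcal{P}^*$ the algebraic dual of $\mathcal{P}$, and $\langle{\bf u},f\rangle$ the action of ${\bf u}\in\mathcal{P}^*$ on $f\in\mathcal{P}$. For $g\in\mathcal{P}$, $g{\bf u}\in\mathcal{P}^*$ is defined by $\langle g{\bf u},f\rangle:=\langle{\bf u},fg\rangle$. An orthogonal polynomial sequence (OPS) with respect to ${\bf u}$ is a sequence $(P_n)_{n\ge0}$ with $\deg P_n=n$ and $\langle{\bf u},P_nP_k\rangle=h_n\delta_{n,k}$, $h_n\in\mathbb{C}\setminus\{0\}$, for all $n,k\ge0$; it is monic if every $P_n$ is monic. ${\bf u}$ is called regular if there exists an OPS with respect to it. Put $$\alpha:=\frac{q^{1/2}+q^{-1/2}}{2},\quad \alpha_n:=\frac{q^{n/2}+q^{-n/2}}{2},\quad \gamma_n:=\frac{q^{n/2}-q^{-n/2}}{q^{1/2}-q^{-1/2}}.$$ The operators $\mathrm{D}_x,\mathrm{S}_x:\mathcal{P}\to\mathcal{P}$ are defined, for $f\in\mathcal{P}$, as the polynomials satisfying (identically in $s$) $$\mathrm{D}_xf(x(s))=\frac{f(x(s+\frac12))-f(x(s-\frac12))}{x(s+\frac12)-x(s-\frac12)},\qquad \mathrm{S}_xf(x(s))=\frac{f(x(s+\frac12))+f(x(s-\frac12))}{2}.$$ They induce operators on $\mathcal{P}^*$: $\langle\mathbf{D}_x{\bf u},f\rangle:=-\langle{\bf u},\mathrm{D}_xf\rangle$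 and $\langle\mathbf{S}_x{\bf u},f\rangle:=\langle{\bf u},\mathrm{S}_xf\rangle$ for $f\in\mathcal{P}$. The pair $(\phi,\psi)\in\mathcal{P}_2\times\mathcal{P}_1$ is called $x$-admissible if $\frac12\gamma_n\phi''+\alpha_n\psi'\neq0$ for all $n=0,1,\ldots$. Let $U_2(z):=(\alpha^2-1)\big((z-\mathfrak{c}_3)^2-4\mathfrak{c}_1\mathfrak{c}_2\big)$. The functionals ${\bf u}^{[k]}\in\mathcal{P}^*$ are defined recursively by ${\bf u}^{[0]}:={\bf u}$ and ${\bf u}^{[k+1]}:=\mathbf{D}_x\big(U_2\psi^{[k]}{\bf u}^{[k]}\big)-\mathbf{S}_x\big(\phi^{[k]}{\bf u}^{[k]}\big)$, $k=0,1,\ldots$, with $\phi^{[k]},\psi^{[k]}$ the polynomials displayed in the claim. *)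

theory Defs
  imports "HOL-Analysis.Analysis" "HOL-Computational_Algebra.Polynomial"
begin

section \<open>Linear functionals on complex polynomials\<close>

definition poly_dual :: "(complex poly \<Rightarrow> complex) set" where
  "poly_dual = {u. Vector_Spaces.linear smult (*) u}"

definition lmult :: "complex poly \<Rightarrow> (complex poly \<Rightarrow> complex) \<Rightarrow> complex poly \<Rightarrow> complex" where
  "lmult g u = (\<lambda>f. u (f * g))"

text \<open>For linear \<open>u\<close> a member of an OPS is nonzero, since \<open>u (P n * P n) \<noteq> 0\<close>; so the convention
  \<open>degree 0 = 0\<close> is harmless here.\<close>

definition is_OPS :: "(complex poly \<Rightarrow> complex) \<Rightarrow> (nat \<Rightarrow> complex poly) \<Rightarrow> bool" where
  "is_OPS u P \<longleftrightarrow> (\<forall>n. degree (P n) = n) \<and>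
     (\<exists>h. (\<forall>n. h n \<noteq> 0) \<and> (\<forall>n k. u (P n * P k) = (if n = k then h n else 0)))"

definition is_monic_OPS :: "(complex poly \<Rightarrow> complex) \<Rightarrow> (nat \<Rightarrow> complex poly) \<Rightarrow> bool" where
  "is_monic_OPS u P \<longleftrightarrow> is_OPS u P \<and> (\<forall>n. lead_coeff (P n) = 1)"

definition regular :: "(complex poly \<Rightarrow> complex) \<Rightarrow> bool" where
  "regular u \<longleftrightarrow> (\<exists>P. is_OPS u P)"

section \<open>The lattice and its operators\<close>

definition lattice :: "real \<Rightarrow> complex \<Rightarrow> complex \<Rightarrow> complex \<Rightarrow> complex \<Rightarrow> complex" where
  "lattice q c1 c2 c3 s =
     c1 * complex_of_real q powr (- s) + c2 * complex_of_real q powr s + c3"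

text \<open>
  The variable \<open>s\<close> is complex. The defining identity of \<open>Dx\<close> is required wherever its denominator
  does not vanish. For \<open>q > 0\<close>, \<open>q \<noteq> 1\<close>, \<open>(c1, c2) \<noteq> (0, 0)\<close> the polynomials described exist,
  because \<open>x (s + 1/2) + x (s - 1/2)\<close> and \<open>x (s + 1/2) * x (s - 1/2)\<close> are polynomials in \<open>x s\<close>,
  and they are unique, because \<open>x s\<close> takes infinitely many values on the \<open>s\<close> considered.
\<close>

definition Dx :: "real \<Rightarrow> complex \<Rightarrow> complex \<Rightarrow> complex \<Rightarrow> complex poly \<Rightarrow> complex poly" where
  "Dx q c1 c2 c3 f = (let x = lattice q c1 c2 c3 in
     THE g. \<forall>s. x (s + 1/2) \<noteq> x (s - 1/2) \<longrightarrow>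
       poly g (x s) = (poly f (x (s + 1/2)) - poly f (x (s - 1/2))) / (x (s + 1/2) - x (s - 1/2)))"

definition Sx :: "real \<Rightarrow> complex \<Rightarrow> complex \<Rightarrow> complex \<Rightarrow> complex poly \<Rightarrow> complex poly" where
  "Sx q c1 c2 c3 f = (let x = lattice q c1 c2 c3 in
     THE g. \<forall>s. poly g (x s) = (poly f (x (s + 1/2)) + poly f (x (s - 1/2))) / 2)"

definition dual_Dx ::
  "real \<Rightarrow> complex \<Rightarrow> complex \<Rightarrow> complex \<Rightarrow> (complex poly \<Rightarrow> complex) \<Rightarrow> complex poly \<Rightarrow> complex" where
  "dual_Dx q c1 c2 c3 u = (\<lambda>f. - u (Dx q c1 c2 c3 f))"

definition dual_Sx ::
  "real \<Rightarrow> complex \<Rightarrow> complex \<Rightarrow> complex \<Rightarrow> (complex poly \<Rightarrow> complex) \<Rightarrow> complex poly \<Rightarrow> complex" where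
  "dual_Sx q c1 c2 c3 u = (\<lambda>f. u (Sx q c1 c2 c3 f))"

section \<open>Coefficients\<close>

definition alphan :: "real \<Rightarrow> nat \<Rightarrow> complex" where
  "alphan q n =
     (complex_of_real q powr (of_nat n / 2) + complex_of_real q powr (- of_nat n / 2)) / 2"

abbreviation alpha :: "real \<Rightarrow> complex" where
  "alpha q \<equiv> alphan q 1"

definition gamman :: "real \<Rightarrow> nat \<Rightarrow> complex" where
  "gamman q n =
     (complex_of_real q powr (of_nat n / 2) - complex_of_real q powr (- of_nat n / 2)) /
     (complex_of_real q powr (1 / 2) - complex_of_real q powr (- 1 / 2))"

definition x_admissible :: "real \<Rightarrow> complex poly \<Rightarrow> complex poly \<Rightarrow> bool" where
  "x_admissible q \<phi> \<psi> \<longleftrightarrow>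
     (\<forall>n. smult (gamman q n / 2) (pderiv (pderiv \<phi>)) + smult (alphan q n) (pderiv \<psi>) \<noteq> 0)"

text \<open>
  Below, \<open>\<phi> = [:c, b, a:]\<close> and \<open>\<psi> = [:e, d:]\<close>, so \<open>a = coeff \<phi> 2\<close> and \<open>d = coeff \<psi> 1\<close>;
  and \<open>[:- c3, 1:]\<close> is the polynomial \<open>z - c3\<close>.
\<close>

definition dn :: "real \<Rightarrow> complex poly \<Rightarrow> complex poly \<Rightarrow> nat \<Rightarrow> complex" where
  "dn q \<phi> \<psi> n = coeff \<phi> 2 * gamman q n + coeff \<psi> 1 * alphan q n"

definition en :: "real \<Rightarrow> complex \<Rightarrow> complex poly \<Rightarrow> complex poly \<Rightarrow> nat \<Rightarrow> complex" where
  "en q c3 \<phi> \<psi> n = poly (pderiv \<phi>) c3 * gamman q n + poly \<psi> c3 * alphan q n"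

definition psin :: "real \<Rightarrow> complex \<Rightarrow> complex poly \<Rightarrow> complex poly \<Rightarrow> nat \<Rightarrow> complex poly" where
  "psin q c3 \<phi> \<psi> n =
     smult (coeff \<phi> 2 * gamman q (2 * n) + coeff \<psi> 1 * alphan q (2 * n)) [:- c3, 1:]
     + [:poly (pderiv \<phi>) c3 * gamman q n + poly \<psi> c3 * alphan q n:]"

definition phin ::
  "real \<Rightarrow> complex \<Rightarrow> complex \<Rightarrow> complex \<Rightarrow> complex poly \<Rightarrow> complex poly \<Rightarrow> nat \<Rightarrow> complex poly" where
  "phin q c1 c2 c3 \<phi> \<psi> n =
     smult (coeff \<psi> 1 * ((alpha q)\<^sup>2 - 1) * gamman q (2 * n) + coeff \<phi> 2 * alphan q (2 * n))
       ([:- c3, 1:]\<^sup>2 - [:2 * c1 * c2:])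
     + smult (poly (pderiv \<phi>) c3 * alphan q n + poly \<psi> c3 * ((alpha q)\<^sup>2 - 1) * gamman q n)
         [:- c3, 1:]
     + [:poly \<phi> c3 + 2 * coeff \<phi> 2 * c1 * c2:]"

definition U2 :: "real \<Rightarrow> complex \<Rightarrow> complex \<Rightarrow> complex \<Rightarrow> complex poly" where
  "U2 q c1 c2 c3 = smult ((alpha q)\<^sup>2 - 1) ([:- c3, 1:]\<^sup>2 - [:4 * c1 * c2:])"

primrec un ::
  "real \<Rightarrow> complex \<Rightarrow> complex \<Rightarrow> complex \<Rightarrow> complex poly \<Rightarrow> complex poly \<Rightarrow>
   (complex poly \<Rightarrow> complex) \<Rightarrow> nat \<Rightarrow> complex poly \<Rightarrow> complex" where
  "un q c1 c2 c3 \<phi> \<psi> u 0 = u"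
| "un q c1 c2 c3 \<phi> \<psi> u (Suc k) = (\<lambda>f.
     dual_Dx q c1 c2 c3 (lmult (U2 q c1 c2 c3 * psin q c3 \<phi> \<psi> k) (un q c1 c2 c3 \<phi> \<psi> u k)) f
     - dual_Sx q c1 c2 c3 (lmult (phin q c1 c2 c3 \<phi> \<psi> k) (un q c1 c2 c3 \<phi> \<psi> u k)) f)"

text \<open>The \<open>n = 0\<close> conventions \<open>\<gamma>\<^sub>0 e\<^sub>-\<^sub>1 / d\<^sub>-\<^sub>2 = 0\<close> and \<open>d\<^sub>-\<^sub>1 / d\<^sub>-\<^sub>1 = 1\<close> are the case distinctions
  in \<open>recB\<close> and \<open>recC\<close>. The value \<open>C\<^sub>0\<close> is arbitrary: it only multiplies \<open>P\<^sub>-\<^sub>1 = 0\<close>.\<close>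

definition recB :: "real \<Rightarrow> complex \<Rightarrow> complex poly \<Rightarrow> complex poly \<Rightarrow> nat \<Rightarrow> complex" where
  "recB q c3 \<phi> \<psi> n =
     c3 + (if n = 0 then 0 else gamman q n * en q c3 \<phi> \<psi> (n - 1) / dn q \<phi> \<psi> (2 * n - 2))
     - gamman q (n + 1) * en q c3 \<phi> \<psi> n / dn q \<phi> \<psi> (2 * n)"

primrec recC ::
  "real \<Rightarrow> complex \<Rightarrow> complex \<Rightarrow> complex \<Rightarrow> complex poly \<Rightarrow> complex poly \<Rightarrow> nat \<Rightarrow> complex" where
  "recC q c1 c2 c3 \<phi> \<psi> 0 = 0"
| "recC q c1 c2 c3 \<phi> \<psi> (Suc n) =
     - (gamman q (n + 1) / dn q \<phi> \<psi> (2 * n + 1)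
        * (if n = 0 then 1 else dn q \<phi> \<psi> (n - 1) / dn q \<phi> \<psi> (2 * n - 1)))
     * poly (phin q c1 c2 c3 \<phi> \<psi> n) (c3 - en q c3 \<phi> \<psi> n / dn q \<phi> \<psi> (2 * n))"

text \<open>In the product \<open>n, j \<ge> 1\<close>, so \<open>n + j - 2\<close> is not truncated.\<close>

definition kn :: "real \<Rightarrow> complex poly \<Rightarrow> complex poly \<Rightarrow> nat \<Rightarrow> complex" where
  "kn q \<phi> \<psi> n = inverse ((- alpha q) ^ n) * (\<Prod>j = 1..n. inverse (dn q \<phi> \<psi> (n + j - 2)))"

end

(*
  Write Y = z - c3 and L_{phi,psi} R = phi * D R + psi * S R, so that the functional equation says
  that u vanishes on the range of L_{phi,psi}.  Product rules for D and S show that each u^[k]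
  satisfies the functional equation with (phi^[k], psi^[k]) and that
  D(R u^[k+1]) = - alpha * L_{phi^[k],psi^[k]}(R) u^[k] for every polynomial R.  Iterating from R = 1
  gives D^n u^[n] = X_n u with deg X_n <= n; the left-hand side kills polynomials of degree < n, so X_n is
  a multiple of P_n.  Following the two leading coefficients in powers of Y through L yields k_n
  and B_n, while u(P_n^2) is a multiple of u^[n](1), whose recursion yields C_n and the criterion.
  If d_N = 0, then X_{N+1} loses its leading coefficient; for a regular u this forces u^[N+1] = 0, and
  descending back to u produces a nonzero polynomial that annihilates u, which is impossible.
*)
theory Submission
  imports Defs
begin

section \<open>Linear functionals\<close>

text \<open>The centred variable \<open>Y = z - c3\<close> is used for its parity: the corrections
  to the leading terms of \<open>D (Y ^ m)\<close> and \<open>S (Y ^ m)\<close> lie two degrees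
  lower. Hence \<open>L\<close> acts on the two top coefficients through the two top coefficients of
  the pair alone, and the index arithmetic becomes the addition theorems of cosh and sinh.

  The polynomials X_n are available before anything is known about regularity. Once no d_n vanishes,
  X_n has degree exactly n and is orthogonal to all lower degrees automatically, so regularity
  reduces to u(P_n^2) being nonzero.

  The delicate point is that regularity forces d_n to be nonzero. During the descent the leading
  coefficient of \<open>L R\<close> may vanish as well; then \<open>R * Y\<close> is used in place
  of \<open>R\<close>, since two consecutive d vanish only if the coefficients a of \<phi> and d of
  \<psi> are both 0. That last case admits no descent and is refuted directly.\<close>

lemma poly_dual_add: "u (f + g) = u f + u g"
  and poly_dual_smult: "u (smult c f) = c * u f"
  if "u \<in> poly_dual"
  using that unfolding poly_dual_def
  by (auto simp: Vector_Spaces.linear_def module_hom_def module_hom_axioms_def)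

lemma poly_dual_0: "u 0 = 0" and poly_dual_diff: "u (f - g) = u f - u g"
  and poly_dual_const_mult: "u ([:c:] * f) = c * u f"
  if "u \<in> poly_dual"
proof -
  show 0: "u 0 = 0"
    using poly_dual_smult [OF that, of 0 0] by simp
  show "u ([:c:] * f) = c * u f"
    using poly_dual_smult [OF that] by simp
  have "u (f - g) + u g = u f"
    using poly_dual_add [OF that, of "f - g" g] by simp
  then show "u (f - g) = u f - u g"
    by (simp add: algebra_simps)
qed

lemma poly_dualI:
  assumes "\<And>f g. u (f + g) = u f + u g" and "\<And>c f. u (smult c f) = c * u f"
  shows "u \<in> poly_dual"
proof -
  have "module (smult :: complex \<Rightarrow> complex poly \<Rightarrow> complex poly)" "module ((*) :: complex \<Rightarrow> complex \<Rightarrow> complex)"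
    by (unfold_locales; simp add: smult_add_right smult_add_left algebra_simps)+
  then show ?thesis
    using assms unfolding poly_dual_def
    by (auto simp: Vector_Spaces.linear_def module_hom_def module_hom_axioms_def vector_space_def module_def)
qed

section \<open>The operators on the lattice\<close>

locale q_lattice =
  fixes q :: real and c1 c2 c3 :: complex
  assumes q_pos: "q > 0" and q_neq_1: "q \<noteq> 1" and c_neq_0: "(c1, c2) \<noteq> (0, 0)"
begin

abbreviation x :: "complex \<Rightarrow> complex" where "x \<equiv> lattice q c1 c2 c3"
abbreviation D :: "complex poly \<Rightarrow> complex poly" where "D \<equiv> Dx q c1 c2 c3"
abbreviation S :: "complex poly \<Rightarrow> complex poly" where "S \<equiv> Sx q c1 c2 c3"
definition Y :: "complex poly" where "Y = [:- c3, 1:]"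
text \<open>A constant polynomial rather than a number, so that identities between \<open>A\<close>,
  \<open>Y\<close> and \<open>U\<close> live in one ring and can be closed by ring
  reasoning.\<close>

definition A :: "complex poly" where "A = [:alpha q:]"
abbreviation U :: "complex poly" where "U \<equiv> U2 q c1 c2 c3"
text \<open>With \<Delta> s = x (s + 1/2) - x (s - 1/2), the value of \<open>U1\<close> at
  \<open>x s\<close> is (\<Delta> (s + 1/2) - \<Delta> (s - 1/2)) / 4, while \<open>U\<close> has
  the value (\<Delta> s / 2)^2. \<open>U1\<close> is the coefficient of \<open>D (D f)\<close> in
  \<open>D (S f) - A * S (D f)\<close>.\<close>

abbreviation U1 :: "complex poly" where "U1 \<equiv> (A\<^sup>2 - 1) * Y"
abbreviation \<gamma> :: "nat \<Rightarrow> complex" where "\<gamma> \<equiv> gamman q"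
abbreviation \<alpha> :: "nat \<Rightarrow> complex" where "\<alpha> \<equiv> alphan q"

section \<open>The numbers \<alpha> n and \<gamma> n\<close>

definition p :: complex where "p = of_real (sqrt q)"

lemma p_neq_0: "p \<noteq> 0"
  using q_pos by (simp add: p_def)

text \<open>A positive real number other than 1 is no root of unity. The nonvanishing of
  \<open>p - inverse p\<close>, of \<gamma> n for n > 0 and of \<alpha> 1 all come from here, with
  exponents 2, 2n and 4.\<close>

lemma p_power_neq_1: "p ^ n \<noteq> 1" if "n > 0"
proof
  assume "p ^ n = 1"
  then have "of_real (sqrt q ^ n) = (1 :: complex)"
    by (simp add: p_def)
  then have "sqrt q ^ n = 1"
    using of_real_eq_1_iff by blast
  then have "sqrt q = 1"
    using that q_pos by (metis power_eq_1_iff abs_of_nonneg less_imp_le real_norm_def real_sqrt_ge_zero neq0_conv)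
  then show False
    using q_neq_1 by simp
qed

lemma powr_half: "complex_of_real q powr (of_nat n / 2) = p ^ n"
proof -
  have "complex_of_real q powr (of_nat n / 2) = (of_real q powr (1 / 2)) ^ n"
    using q_pos by (subst powr_power) auto
  also have "of_real q powr (1 / 2) = p"
    using q_pos by (simp add: p_def csqrt_conv_powr [symmetric] of_real_sqrt flip: csqrt_of_real_nonneg)
  finally show ?thesis .
qed

lemma powr_minus_half: "complex_of_real q powr (- of_nat n / 2) = inverse p ^ n"
  using powr_half [of n] by (simp add: powr_minus power_inverse)

lemma alphan_p: "\<alpha> n = (p ^ n + inverse p ^ n) / 2"
  unfolding alphan_def powr_half powr_minus_half ..

lemma gamman_p: "\<gamma> n = (p ^ n - inverse p ^ n) / (p - inverse p)"
proof -
  have "complex_of_real q powr (1 / 2) = p" "complex_of_real q powr (- 1 / 2) = inverse p"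
    using powr_half [of 1] powr_minus_half [of 1] by simp_all
  then show ?thesis
    unfolding gamman_def powr_half powr_minus_half by simp
qed

lemma p_minus_inverse: "p - inverse p \<noteq> 0"
  using p_power_neq_1 [of 2] p_neq_0 by (auto simp: field_simps power2_eq_square)

lemma gamman_0 [simp]: "\<gamma> 0 = 0" and alphan_0 [simp]: "\<alpha> 0 = 1"
  and gamman_1 [simp]: "\<gamma> (Suc 0) = 1"
  using p_minus_inverse by (auto simp: gamman_p alphan_p)

text \<open>With p = exp t, \<alpha> n is cosh (n t), \<gamma> n is sinh (n t) / sinh t, and
  \<open>(alpha q)\<^sup>2 - 1\<close> is the square of sinh t; this and \<open>alphan_add\<close>
  are the addition theorems.\<close>

lemma gamman_add: "\<gamma> (m + n) = \<gamma> m * \<alpha> n + \<alpha> m * \<gamma> n"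
proof -
  have "\<gamma> m * \<alpha> n + \<alpha> m * \<gamma> n =
    ((p ^ m - inverse p ^ m) * (p ^ n + inverse p ^ n) + (p ^ m + inverse p ^ m) * (p ^ n - inverse p ^ n))
    / (2 * (p - inverse p))"
    using p_minus_inverse by (simp add: gamman_p alphan_p divide_simps)
  also have "\<dots> = (2 * (p ^ (m + n) - inverse p ^ (m + n))) / (2 * (p - inverse p))"
    by (simp only: power_add algebra_simps) simp
  also have "\<dots> = \<gamma> (m + n)"
    unfolding gamman_p by (subst mult_divide_mult_cancel_left) simp_all
  finally show ?thesis ..
qed

lemma alpha_sq_minus_1: "(alpha q)\<^sup>2 - 1 = (p - inverse p)\<^sup>2 / 4"
  using p_neq_0 by (simp add: alphan_p field_simps power2_eq_square)

lemma alphan_add: "\<alpha> (m + n) = \<alpha> m * \<alpha> n + ((alpha q)\<^sup>2 - 1) * \<gamma> m * \<gamma> n"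
proof -
  have "((alpha q)\<^sup>2 - 1) * \<gamma> m * \<gamma> n = (p ^ m - inverse p ^ m) * (p ^ n - inverse p ^ n) / 4"
  proof -
    have "t\<^sup>2 / 4 * (a / t) * (b / t) = a * b / 4" if "t \<noteq> 0" for a b t :: complex
      using that by (simp add: power2_eq_square)
    then show ?thesis
      using p_minus_inverse unfolding alpha_sq_minus_1 gamman_p by blast
  qed
  moreover have "\<alpha> m * \<alpha> n = (p ^ m + inverse p ^ m) * (p ^ n + inverse p ^ n) / 4"
    by (simp add: alphan_p)
  ultimately have "\<alpha> m * \<alpha> n + ((alpha q)\<^sup>2 - 1) * \<gamma> m * \<gamma> n =
    (p ^ m + inverse p ^ m) * (p ^ n + inverse p ^ n) / 4 + (p ^ m - inverse p ^ m) * (p ^ n - inverse p ^ n) / 4"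
    by (simp only:)
  also have "\<dots> = \<alpha> (m + n)"
    unfolding alphan_p power_add
    by (simp add: algebra_simps add_divide_distrib diff_divide_distrib del: power_inverse)
  finally show ?thesis ..
qed

lemma gamman_Suc: "\<gamma> (Suc n) = alpha q * \<gamma> n + \<alpha> n"
  and alphan_Suc: "\<alpha> (Suc n) = alpha q * \<alpha> n + ((alpha q)\<^sup>2 - 1) * \<gamma> n"
  using gamman_add [of 1 n] alphan_add [of 1 n] by simp_all

lemma gamman_eq_0_iff [simp]: "\<gamma> n = 0 \<longleftrightarrow> n = 0"
proof (cases "n = 0")
  case False
  have "p ^ n \<noteq> inverse p ^ n"
    using p_power_neq_1 [of "n + n"] p_neq_0 False by (auto simp: power_add field_simps)
  with False show ?thesis
    using p_minus_inverse by (simp add: gamman_p)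
qed simp

lemma alpha_neq_0: "alpha q \<noteq> 0"
proof
  assume "alpha q = 0"
  then have "p ^ 2 = - 1"
    using p_neq_0 by (simp add: alphan_p field_simps power2_eq_square)
       (metis add_eq_0_iff)
  then have "p ^ 4 = 1"
    by (simp add: power4_eq_xxxx power2_eq_square)
  then show False
    using p_power_neq_1 [of 4] by simp
qed

section \<open>Points of the lattice; existence and uniqueness of \<open>D f\<close> and
  \<open>S f\<close>\<close>

definition E :: "complex \<Rightarrow> complex" where "E s = of_real q powr s"

lemma E_neq_0: "E s \<noteq> 0"
  using q_pos by (simp add: E_def)

lemma x_E: "x s = c1 / E s + c2 * E s + c3"
  by (simp add: lattice_def E_def powr_minus field_simps)

lemma E_shift: "E (s + 1 / 2) = E s * p" "E (s - 1 / 2) = E s / p"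
  using powr_half [of 1] by (simp_all add: E_def powr_add powr_diff)

definition xp :: "complex \<Rightarrow> complex" where "xp s = x (s + 1 / 2)"
definition xm :: "complex \<Rightarrow> complex" where "xm s = x (s - 1 / 2)"

lemma x_shift: "xp s = c1 / E s / p + c2 * E s * p + c3"
  "xm s = c1 / E s * p + c2 * E s / p + c3"
  unfolding xp_def xm_def x_E E_shift by simp_all

lemma x_sum: "xp s + xm s = 2 * (alpha q * (x s - c3) + c3)"
  using p_neq_0 E_neq_0 [of s] unfolding x_shift x_E alphan_p by (simp add: field_simps)

lemma x_diff: "xp s - xm s = (p - inverse p) * (c2 * E s - c1 / E s)"
  using p_neq_0 E_neq_0 [of s] unfolding x_shift by (simp add: field_simps)

lemma poly_U: "poly U (x s) = (xp s - xm s)\<^sup>2 / 4"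
proof -
  have "(c1 / E s + c2 * E s)\<^sup>2 - 4 * c1 * c2 = (c2 * E s - c1 / E s)\<^sup>2"
    using E_neq_0 [of s] by (simp add: field_simps power2_eq_square)
  then show ?thesis
    unfolding x_diff U2_def alpha_sq_minus_1 by (simp add: x_E power_mult_distrib)
qed

abbreviation nondegenerate_point :: "complex \<Rightarrow> bool" where
  "nondegenerate_point s \<equiv> xp s \<noteq> xm s"

text \<open>With t = \<open>E s\<close> the equation is c2 t^2 - (z - c3) t + c1 = 0, and
  \<open>E\<close> takes every nonzero value. The discriminant equals (c2 t - c1 / t)^2, which up to
  a nonzero factor is the square of \<open>xp s - xm s\<close>; so it being nonzero gives
  nondegeneracy.\<close>

lemma lattice_surj:
  assumes "z \<noteq> c3" and "(z - c3)\<^sup>2 \<noteq> 4 * c1 * c2"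
  shows "\<exists>s. nondegenerate_point s \<and> x s = z"
proof -
  obtain t where t: "t \<noteq> 0" "c1 / t + c2 * t + c3 = z"
  proof (cases "c2 = 0")
    case True
    with c_neq_0 have "c1 \<noteq> 0" by simp
    then show ?thesis
      using True assms by (intro that [of "c1 / (z - c3)"]) (auto simp: field_simps)
  next
    case False
    define r where "r = csqrt ((z - c3)\<^sup>2 - 4 * c1 * c2)"
    have r: "r\<^sup>2 = (z - c3)\<^sup>2 - 4 * c1 * c2"
      by (simp add: r_def)
    have root: "c1 / t + c2 * t + c3 = z" if "t = ((z - c3) + e * r) / (2 * c2)" "e\<^sup>2 = 1" "t \<noteq> 0" for t e
    proof -
      have et: "2 * c2 * t - (z - c3) = e * r"
        using that(1) False by (simp add: field_simps)
      have "(2 * c2 * t - (z - c3))\<^sup>2 = (z - c3)\<^sup>2 - 4 * c1 * c2"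
        unfolding et using r that(2) by (simp add: power_mult_distrib)
      then have "4 * c2 * (c2 * t\<^sup>2 - (z - c3) * t + c1) = 0"
        by algebra
      then have "c2 * t\<^sup>2 - (z - c3) * t + c1 = 0"
        using False by simp
      then show ?thesis
        using that(3) by (simp add: field_simps power2_eq_square)
    qed
    define t where "t = ((z - c3) + 1 * r) / (2 * c2)"
    define t' where "t' = ((z - c3) + (- 1) * r) / (2 * c2)"
    \<comment> \<open>The sum of the two roots is nonzero, so at least one of them is an admissible
      value of \<open>E\<close>.\<close>
    have "t + t' = (z - c3) / c2"
      using False by (simp add: t_def t'_def field_simps)
    then have "t + t' \<noteq> 0"
      using assms(1) False by simp
    then have "t \<noteq> 0 \<or> t' \<noteq> 0" by auto
    then show ?thesis
      using that root [OF t_def] root [OF t'_def] by auto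
  qed
  define s where "s = Ln t / Ln (of_real q)"
  have "Ln (of_real q) \<noteq> 0"
    using q_pos q_neq_1 by (simp add: Ln_of_real)
  then have Es: "E s = t"
    using t(1) q_pos by (simp add: E_def s_def powr_def)
  have xs: "x s = z"
    using t by (simp add: x_E Es)
  have "(c2 * t - c1 / t)\<^sup>2 = (c1 / t + c2 * t)\<^sup>2 - 4 * c1 * c2"
    using t(1) by (simp add: field_simps power2_eq_square)
  also have "c1 / t + c2 * t = z - c3"
    using t(2) by (simp add: algebra_simps)
  finally have "(c2 * t - c1 / t)\<^sup>2 \<noteq> 0"
    using assms(2) by simp
  then have "nondegenerate_point s"
    using x_diff [of s] p_minus_inverse by (auto simp: Es)
  with xs show ?thesis by blast
qed

text \<open>The values not covered by \<open>lattice_surj\<close> are zeros of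
  \<open>Y * (Y\<^sup>2 - [:4 * c1 * c2:])\<close>; multiplied by this nonzero polynomial,
  \<open>f - g\<close> vanishes everywhere.\<close>

lemma poly_eqI_lattice:
  assumes "\<And>s. nondegenerate_point s \<Longrightarrow> poly f (x s) = poly g (x s)"
  shows "f = g"
proof -
  let ?h = "(f - g) * (Y * (Y\<^sup>2 - [:4 * c1 * c2:]))"
  have "poly ?h z = 0" for z
  proof (cases "z = c3 \<or> (z - c3)\<^sup>2 = 4 * c1 * c2")
    case True
    then show ?thesis by (auto simp: Y_def)
  next
    case False
    then obtain s where "nondegenerate_point s" "x s = z"
      using lattice_surj by blast
    then show ?thesis using assms by auto
  qed
  then have "?h = 0"
    using poly_all_0_iff_0 by blast
  moreover have "Y * (Y\<^sup>2 - [:4 * c1 * c2:]) \<noteq> 0"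
    by (simp add: power2_eq_square Y_def)
  ultimately show ?thesis
    by simp
qed

text \<open>Both polynomials are built together along f -> a + z f, because the product rule for
  either operator involves the other. Here \<open>\<sigma>\<close> is the average of z, and
  \<open>U\<close> turns a product of two difference quotients back into a product of
  differences.\<close>

lemma DS_exist:
  "\<exists>g h. (\<forall>s. nondegenerate_point s \<longrightarrow>
       poly g (x s) = (poly f (xp s) - poly f (xm s)) / (xp s - xm s)) \<and>
     (\<forall>s. poly h (x s) = (poly f (xp s) + poly f (xm s)) / 2)"
proof (induction f rule: pCons_induct)
  case 0
  show ?case by (intro exI [of _ 0]) auto
next
  case (pCons a f)
  then obtain g h where g: "\<And>s. nondegenerate_point s \<Longrightarrow>
       poly g (x s) = (poly f (xp s) - poly f (xm s)) / (xp s - xm s)"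
    and h: "\<And>s. poly h (x s) = (poly f (xp s) + poly f (xm s)) / 2"
    by blast
  define \<sigma> where "\<sigma> = A * Y + [:c3:]"
  have \<sigma>: "poly \<sigma> (x s) = (xp s + xm s) / 2" for s
    unfolding x_sum \<sigma>_def by (simp add: A_def Y_def,  simp add: algebra_simps)
  show ?case
  proof (rule exI [of _ "h + \<sigma> * g"], rule exI [of _ "[:a:] + U * g + \<sigma> * h"], intro conjI allI impI)
    fix s assume s: "nondegenerate_point s"
    then show "poly (h + \<sigma> * g) (x s) = (poly (pCons a f) (xp s) - poly (pCons a f) (xm s)) / (xp s - xm s)"
      by (simp add: g h \<sigma> divide_simps) (simp add: algebra_simps)
  next
    fix s
    show "poly ([:a:] + U * g + \<sigma> * h) (x s) = (poly (pCons a f) (xp s) + poly (pCons a f) (xm s)) / 2"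
    proof (cases "nondegenerate_point s")
      case True
      define t where "t = xp s - xm s"
      with True have t: "t \<noteq> 0" "xp s = xm s + t" by simp_all
      have "poly U (x s) * poly g (x s) = t * (poly f (xp s) - poly f (xm s)) / 4"
        using t(1) True by (simp add: g poly_U power2_eq_square flip: t_def)
      then show ?thesis
        by (simp add: h \<sigma> t(2)) (simp add: field_simps)
    next
      \<comment> \<open>At such a point the induction hypothesis says nothing about
        \<open>g\<close>, but its factor \<open>U\<close> is zero there.\<close>
      case False
      then show ?thesis
        by (simp add: h \<sigma> poly_U)
    qed
  qed
qed

lemma poly_D: "poly (D f) (x s) =
    (poly f (xp s) - poly f (xm s)) / (xp s - xm s)"
  if "nondegenerate_point s"
proof -
  let ?P = "\<lambda>g. \<forall>s. nondegenerate_point s \<longrightarrow>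
    poly g (x s) = (poly f (xp s) - poly f (xm s)) / (xp s - xm s)"
  obtain g where g: "?P g" using DS_exist by blast
  have "h = g" if h: "?P h" for h
  proof (rule poly_eqI_lattice)
    fix s assume "nondegenerate_point s"
    with g h show "poly h (x s) = poly g (x s)" by metis
  qed
  with g have "\<exists>!g. ?P g"
    by (rule ex1I)
  then have "?P (THE g. ?P g)"
    by (rule theI')
  then show ?thesis
    using that unfolding Dx_def Let_def xp_def xm_def by blast
qed

lemma poly_S: "poly (S f) (x s) = (poly f (xp s) + poly f (xm s)) / 2"
proof -
  let ?P = "\<lambda>g. \<forall>s. poly g (x s) = (poly f (xp s) + poly f (xm s)) / 2"
  obtain g where g: "?P g" using DS_exist by blast
  have "h = g" if h: "?P h" for h
  proof (rule poly_eqI_lattice)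
    fix s assume "nondegenerate_point s"
    with g h show "poly h (x s) = poly g (x s)" by metis
  qed
  with g have "\<exists>!g. ?P g"
    by (rule ex1I)
  then have "?P (THE g. ?P g)"
    by (rule theI')
  then show ?thesis
    unfolding Sx_def Let_def xp_def xm_def by blast
qed

section \<open>Product and commutation rules\<close>

lemma D_add: "D (f + g) = D f + D g"
  and D_diff: "D (f - g) = D f - D g"
  and S_add: "S (f + g) = S f + S g"
  and S_diff: "S (f - g) = S f - S g"
  and D_const [simp]: "D [:a:] = 0"
  and S_const [simp]: "S [:a:] = [:a:]"
  and D_Y: "D Y = 1"
  by (rule poly_eqI_lattice, simp add: poly_D poly_S Y_def diff_divide_distrib add_divide_distrib)+

lemma S_Y: "S Y = A * Y"
proof (rule poly_eqI_lattice)
  fix s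
  show "poly (S Y) (x s) = poly (A * Y) (x s)"
    using x_sum [of s] by (simp add: poly_S A_def Y_def field_simps)
qed

lemma D_mult: "D (f * g) = D f * S g + S f * D g"
proof (rule poly_eqI_lattice)
  fix s assume s: "nondegenerate_point s"
  have "(a * c - b * d) / t = (a - b) / t * ((c + d) / 2) + (a + b) / 2 * ((c - d) / t)"
    for a b c d t :: complex
    by (cases "t = 0") (simp_all add: field_simps)
  with s show "poly (D (f * g)) (x s) = poly (D f * S g + S f * D g) (x s)"
    by (simp only: poly_D poly_S poly_mult poly_add not_False_eq_True)
qed

text \<open>From 2 (a c + b d) = (a - b) (c - d) + (a + b) (c + d); the factor \<open>U\<close>, a
  quarter of the squared step, absorbs the denominators of the two quotients.\<close>

lemma S_mult: "S (f * g) = U * D f * D g + S f * S g"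
proof (rule poly_eqI_lattice)
  fix s assume s: "nondegenerate_point s"
  have "(a * c + b * d) / 2 = t\<^sup>2 / 4 * ((a - b) / t) * ((c - d) / t) + (a + b) / 2 * ((c + d) / 2)"
    if "t \<noteq> 0" for a b c d t :: complex
  proof -
    have "t\<^sup>2 / 4 * ((a - b) / t) * ((c - d) / t) = (a - b) * (c - d) / 4"
      using that by (simp add: power2_eq_square)
    then show ?thesis
      by (simp only:) (simp add: field_simps)
  qed
  with s show "poly (S (f * g)) (x s) = poly (U * D f * D g + S f * S g) (x s)"
    by (simp only: poly_D poly_S poly_mult poly_add poly_U right_minus_eq not_False_eq_True)
qed

lemma D_0 [simp]: "D 0 = 0" and S_0 [simp]: "S 0 = 0"
  and D_1 [simp]: "D 1 = 0" and S_1 [simp]: "S 1 = 1"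
  using D_const [of 0] S_const [of 0] D_const [of 1] S_const [of 1]
  by (simp_all flip: one_pCons)

lemma D_const_mult: "D ([:a:] * f) = [:a:] * D f"
  and S_const_mult: "S ([:a:] * f) = [:a:] * S f"
  by (simp_all only: D_mult S_mult D_const S_const) simp_all

text \<open>Horner's scheme in powers of \<open>Y\<close> instead of z: \<open>D Y = 1\<close> and
  \<open>S Y = A * Y\<close> carry no additive constant, which keeps the induction steps ring
  identities.\<close>

lemma Y_induct [case_names 0 step]:
  assumes "P 0" and "\<And>a f. P f \<Longrightarrow> P ([:a:] + Y * f)"
  shows "P f"
proof -
  have "P (pcompose g Y)" for g
    by (induction g rule: pCons_induct) (simp_all only: assms pcompose_0 pcompose_pCons)
  moreover have "pcompose (pcompose f [:c3, 1:]) Y = f"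
    by (simp add: pcompose_pCons Y_def flip: pcompose_assoc)
  ultimately show ?thesis by metis
qed

lemma S_A: "S A = A" and D_A: "D A = 0"
  by (simp_all add: A_def)

lemma D_YM: "D (Y * f) = S f + A * Y * D f"
  and S_YM: "S (Y * f) = U * D f + A * Y * S f"
  by (simp_all only: D_mult S_mult D_Y S_Y) simp_all

lemma U_eq: "U = (A\<^sup>2 - 1) * (Y\<^sup>2 - [:4 * c1 * c2:])"
  by (simp add: U2_def Y_def A_def power2_eq_square one_pCons)

lemma D_A2: "D (A\<^sup>2 - 1) = 0" and S_A2: "S (A\<^sup>2 - 1) = A\<^sup>2 - 1"
  by (simp_all add: power2_eq_square D_diff S_diff D_mult S_mult D_A S_A)

lemma A_mult: "D (A * f) = A * D f" "S (A * f) = A * S f"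
  by (simp_all add: D_mult S_mult D_A S_A)

lemma A2_mult: "D ((A\<^sup>2 - 1) * f) = (A\<^sup>2 - 1) * D f" "S ((A\<^sup>2 - 1) * f) = (A\<^sup>2 - 1) * S f"
  by (simp_all only: D_mult S_mult D_A2 S_A2) simp_all

lemma D_U1: "D U1 = A\<^sup>2 - 1" and S_U1: "S U1 = A * U1"
  by (simp_all only: A2_mult D_Y S_Y) (simp_all add: algebra_simps)

lemma D_U: "D U = 2 * A * U1"
  unfolding U_eq A2_mult D_diff power2_eq_square [of Y] D_YM S_Y D_Y D_const by algebra

lemma S_U: "S U = A\<^sup>2 * U + U1\<^sup>2"
proof -
  have "S U = (A\<^sup>2 - 1) * (U + A\<^sup>2 * Y\<^sup>2 - [:4 * c1 * c2:])"
    unfolding U_eq A2_mult S_diff power2_eq_square [of Y] S_YM S_Y D_Y S_const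
    by (simp add: algebra_simps power2_eq_square)
  then show ?thesis
    unfolding U_eq by algebra
qed

text \<open>Proved simultaneously: for \<open>[:a:] + Y * f\<close> each of the two identities needs
  both of them for \<open>f\<close>, since \<open>D_YM\<close> and \<open>S_YM\<close> mix the
  operators. What remains is an identity in \<open>S (D f)\<close>, \<open>D (D f)\<close>,
  \<open>f\<close>, \<open>A\<close>, \<open>Y\<close>, \<open>U\<close>, \<open>U1\<close>.\<close>

lemma DS_comm: "D (S f) = A * S (D f) + U1 * D (D f)"
  and SS: "S (S f) = U1 * S (D f) + A * U * D (D f) + f"
proof -
  have "D (S f) = A * S (D f) + U1 * D (D f) \<and> S (S f) = U1 * S (D f) + A * U * D (D f) + f"
  proof (induction f rule: Y_induct)
    case 0
    show ?case by simp
  next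
    case (step a f)
    define P Q where "P = S (D f)" and "Q = D (D f)"
    have 1: "D (S f) = A * P + U1 * Q" and 2: "S (S f) = U1 * P + A * U * Q + f"
      using step by (simp_all only: P_def Q_def)
    have Df: "D ([:a:] + Y * f) = S f + A * (Y * D f)"
      by (simp only: D_add D_const D_YM) algebra
    have Sf: "S ([:a:] + Y * f) = [:a:] + U * D f + A * (Y * S f)"
      by (simp only: S_add S_const S_YM) algebra
    have DD: "D (S f + A * (Y * D f)) = (A * P + U1 * Q) + A * (P + A * Y * Q)"
      by (simp only: D_add A_mult D_YM 1 P_def Q_def)
    have SD: "S (S f + A * (Y * D f)) = (U1 * P + A * U * Q + f) + A * (U * Q + A * Y * P)"
      by (simp only: S_add A_mult S_YM 2 P_def Q_def)
    have DS: "D ([:a:] + U * D f + A * (Y * S f)) =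
        (2 * A * U1 * P + (A\<^sup>2 * U + U1\<^sup>2) * Q) + A * (U1 * P + A * U * Q + f + A * Y * (A * P + U1 * Q))"
      by (simp only: D_add D_const D_mult [of U] D_U S_U A_mult D_YM 1 2 P_def Q_def) simp
    have SS: "S ([:a:] + U * D f + A * (Y * S f)) =
        [:a:] + (U * (2 * A * U1) * Q + (A\<^sup>2 * U + U1\<^sup>2) * P) + A * (U * (A * P + U1 * Q) + A * Y * (U1 * P + A * U * Q + f))"
      by (simp only: S_add S_const S_mult [of U] D_U S_U A_mult S_YM 1 2 P_def Q_def)
    show ?case
      unfolding Df Sf DD SD DS SS
    proof
      show "2 * A * U1 * P + (A\<^sup>2 * U + U1\<^sup>2) * Q + A * (U1 * P + A * U * Q + f + A * Y * (A * P + U1 * Q)) =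
        A * (U1 * P + A * U * Q + f + A * (U * Q + A * Y * P)) + U1 * (A * P + U1 * Q + A * (P + A * Y * Q))"
        by algebra
      show "[:a:] + (U * (2 * A * U1) * Q + (A\<^sup>2 * U + U1\<^sup>2) * P) + A * (U * (A * P + U1 * Q) + A * Y * (U1 * P + A * U * Q + f)) =
        U1 * (U1 * P + A * U * Q + f + A * (U * Q + A * Y * P)) + A * U * (A * P + U1 * Q + A * (P + A * Y * Q)) + ([:a:] + Y * f)"
        by algebra
    qed
  qed
  then show "D (S f) = A * S (D f) + U1 * D (D f)" "S (S f) = U1 * S (D f) + A * U * D (D f) + f"
    by blast+
qed

text \<open>The combination is made so that the \<open>D (D f)\<close> terms cancel under
  \<open>D\<close> and the \<open>S (D f)\<close> terms cancel under \<open>S\<close>. What is left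
  is \<open>D\<close> and \<open>S\<close> of \<open>D f\<close> with their roles exchanged, plus
  the term \<open>A * f\<close>.\<close>

lemma D_test: "D (A * S f - U1 * D f) = S (D f)"
  and S_test: "S (A * S f - U1 * D f) = U * D (D f) + A * f"
proof -
  show "D (A * S f - U1 * D f) = S (D f)"
    by (simp only: D_diff A_mult D_mult [of U1] D_U1 S_U1 DS_comm) (simp add: algebra_simps power2_eq_square)
  show "S (A * S f - U1 * D f) = U * D (D f) + A * f"
    by (simp only: S_diff A_mult S_mult [of U1] D_U1 S_U1 SS) (simp add: algebra_simps power2_eq_square)
qed

section \<open>The functional equation as an operator on polynomials\<close>

definition L :: "complex poly \<Rightarrow> complex poly \<Rightarrow> complex poly \<Rightarrow> complex poly" where
  "L \<phi> \<psi> R = \<phi> * D R + \<psi> * S R"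

text \<open>The functional equation for \<open>u\<close> is used on the test function \<open>R * (A * S f - U1 * D f)\<close>.\<close>

lemma L_test:
  "U * \<psi> * D (R * D f) + \<phi> * S (R * D f) + A * L \<phi> \<psi> R * f = L \<phi> \<psi> (R * (A * S f - U1 * D f))"
  unfolding L_def D_mult [of R] S_mult [of R] D_test S_test by algebra

text \<open>
  Let \<open>\<Delta> s = x (s + 1/2) - x (s - 1/2)\<close> and \<open>w\<^sub>\<plusminus> = 2 * \<phi> \<plusminus> \<Delta> * \<psi>\<close>. The pair \<open>(\<phi>', \<psi>')\<close> is the one whose
  \<open>w'\<^sub>\<plusminus>\<close> are the half-step shifts of \<open>w\<^sub>\<plusminus>\<close>. In terms of values at \<open>s - 1, s, s + 1\<close> the test function on
  the right is the only one for which the values of \<open>f\<close> at \<open>s \<plusminus> 1\<close> match; those at \<open>s\<close> then match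
  because \<open>\<Delta> (s + 1) + \<Delta> s = 2 * alpha * \<Delta> (s + 1/2)\<close>.
\<close>

lemma pearson_step_identity:
  fixes \<phi> \<psi> f :: "complex poly"
  defines "\<phi>' \<equiv> S \<phi> + U1 * S \<psi> + A * U * D \<psi>"
    and "\<psi>' \<equiv> D \<phi> + A * S \<psi> + U1 * D \<psi>"
  shows "U * \<psi> * D (L \<phi>' \<psi>' f) + \<phi> * S (L \<phi>' \<psi>' f) =
    L \<phi> \<psi> (A * (\<phi>' * S f + U * \<psi>' * D f) - U1 * L \<phi>' \<psi>' f)"
proof -
  define P1 Q1 P2 Q2 P Q where "P1 = S (D \<phi>)" and "Q1 = D (D \<phi>)" and "P2 = S (D \<psi>)" and "Q2 = D (D \<psi>)"
    and "P = S (D f)" and "Q = D (D f)"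
  note PQ = this
  have shape: "\<phi>' = S \<phi> + (U1 * S \<psi> + A * (U * D \<psi>))" "\<psi>' = D \<phi> + (A * S \<psi> + U1 * D \<psi>)"
    by (simp_all add: \<phi>'_def \<psi>'_def algebra_simps)
  have U1D: "D (U1 * g) = (A\<^sup>2 - 1) * S g + A * U1 * D g"
    and U1S: "S (U1 * g) = U * (A\<^sup>2 - 1) * D g + A * U1 * S g"
    and UD: "D (U * g) = 2 * A * U1 * S g + (A\<^sup>2 * U + U1\<^sup>2) * D g"
    and US: "S (U * g) = U * (2 * A * U1) * D g + (A\<^sup>2 * U + U1\<^sup>2) * S g" for g
    by (simp_all only: D_mult [of U] D_mult [of U1] S_mult [of U1] S_mult [of U] D_U S_U D_U1 S_U1)
  note rules = D_add S_add A_mult U1D U1S UD US DS_comm SS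
  have 1: "D \<phi>' = A * P1 + U1 * Q1 + ((A\<^sup>2 - 1) * (U1 * P2 + A * U * Q2 + \<psi>) + A * U1 * (A * P2 + U1 * Q2) + A * (2 * A * U1 * P2 + (A\<^sup>2 * U + U1\<^sup>2) * Q2))"
    and 2: "S \<phi>' = U1 * P1 + A * U * Q1 + \<phi> + (U * (A\<^sup>2 - 1) * (A * P2 + U1 * Q2) + A * U1 * (U1 * P2 + A * U * Q2 + \<psi>) + A * (U * (2 * A * U1) * Q2 + (A\<^sup>2 * U + U1\<^sup>2) * P2))"
    and 3: "D \<psi>' = Q1 + (A * (A * P2 + U1 * Q2) + ((A\<^sup>2 - 1) * P2 + A * U1 * Q2))"
    and 4: "S \<psi>' = P1 + (A * (U1 * P2 + A * U * Q2 + \<psi>) + (U * (A\<^sup>2 - 1) * Q2 + A * U1 * P2))"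
    unfolding shape rules PQ by (rule refl)+
  define F h where "F = L \<phi>' \<psi>' f" and "h = \<phi>' * S f + U * (\<psi>' * D f)"
  have DF: "D F = D \<phi>' * P + S \<phi>' * Q + (D \<psi>' * S (S f) + S \<psi>' * D (S f))"
    and SF: "S F = U * D \<phi>' * Q + S \<phi>' * P + (U * D \<psi>' * D (S f) + S \<psi>' * S (S f))"
    by (simp_all only: F_def L_def D_add S_add D_mult S_mult PQ)
  have "D h = D \<phi>' * S (S f) + S \<phi>' * D (S f)
      + (2 * A * U1 * (U * D \<psi>' * Q + S \<psi>' * P) + (A\<^sup>2 * U + U1\<^sup>2) * (D \<psi>' * P + S \<psi>' * Q))"
    unfolding h_def D_add UD D_mult [of \<phi>'] D_mult [of \<psi>'] S_mult [of \<psi>'] PQ by (rule refl)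
  also have "\<dots> = A * S F + U1 * D F - f * \<psi>"
    unfolding DF SF DS_comm [of f] SS [of f] PQ [symmetric] 1 2 3 4
    by (simp only: algebra_simps power2_eq_square mult_2 mult_2_right mult_1_left mult_1_right)
  finally have Dh: "D h = A * S F + U1 * D F - f * \<psi>" .
  have "S h = U * D \<phi>' * D (S f) + S \<phi>' * S (S f)
      + (U * (2 * A * U1) * (D \<psi>' * P + S \<psi>' * Q) + (A\<^sup>2 * U + U1\<^sup>2) * (U * D \<psi>' * Q + S \<psi>' * P))"
    unfolding h_def S_add US S_mult [of \<phi>'] D_mult [of \<psi>'] S_mult [of \<psi>'] PQ by (rule refl)
  also have "\<dots> = A * U * D F + U1 * S F + f * \<phi>"
    unfolding DF SF DS_comm [of f] SS [of f] PQ [symmetric] 1 2 3 4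
    by (simp only: algebra_simps power2_eq_square mult_2 mult_2_right mult_1_left mult_1_right)
  finally have Sh: "S h = A * U * D F + U1 * S F + f * \<phi>" .
  \<comment> \<open>The same combination as in \<open>D_test\<close>. The leftovers
    \<open>- A * f * \<psi>\<close> and \<open>A * f * \<phi>\<close> cancel when these are
    multiplied by \<phi> and \<psi> and added.\<close>
  have "D (A * h - U1 * F) = S F - A * f * \<psi>" "S (A * h - U1 * F) = U * D F + A * f * \<phi>"
    unfolding D_diff S_diff A_mult U1D U1S Dh Sh by (simp_all add: algebra_simps power2_eq_square)
  then have "U * \<psi> * D F + \<phi> * S F = L \<phi> \<psi> (A * h - U1 * F)"
    unfolding L_def by (simp only:) (simp add: algebra_simps)
  then show ?thesis
    by (simp add: F_def h_def mult.assoc)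
qed

section \<open>Degree bounds and leading coefficients in powers of \<open>Y\<close>\<close>

text \<open>The polynomials of degree less than \<open>k\<close>, with \<open>V k = {0}\<close> for \<open>k \<le> 0\<close>; the integer index makes
  lowering the degree bound free of truncation.\<close>

definition V :: "int \<Rightarrow> complex poly set" where
  "V k = {f. \<forall>i. k \<le> int i \<longrightarrow> coeff f i = 0}"

lemma V_degree: "f \<in> V k \<longleftrightarrow> f = 0 \<or> int (degree f) < k"
proof
  assume f: "f \<in> V k"
  then have "coeff f (degree f) = 0" if "k \<le> int (degree f)"
    using that by (simp add: V_def)
  then show "f = 0 \<or> int (degree f) < k"
    using leading_coeff_0_iff by fastforce
qed (auto simp: V_def intro: coeff_eq_0)

lemma V_add: "f \<in> V k \<Longrightarrow> g \<in> V k \<Longrightarrow> f + g \<in> V k"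
  and V_diff: "f \<in> V k \<Longrightarrow> g \<in> V k \<Longrightarrow> f - g \<in> V k"
  and V_0 [simp]: "0 \<in> V k"
  by (auto simp: V_def)

lemma V_mono: "f \<in> V j \<Longrightarrow> j \<le> k \<Longrightarrow> f \<in> V k"
  by (auto simp: V_def)

lemma V_mult: "f * g \<in> V (k + int m)" if "degree f \<le> m" "g \<in> V k"
  using that degree_mult_le [of f g] unfolding V_degree by fastforce

lemma V_const_mult: "[:a:] * g \<in> V k" "A * g \<in> V k" if "g \<in> V k"
  using V_mult [of "[:a:]" 0 g k] V_mult [of A 0 g k] that by (simp_all add: A_def)

lemma V_step:
  assumes "[:a:] + Y * f \<in> V k"
  shows "f \<in> V (k - 1)" and "k \<le> 0 \<Longrightarrow> a = 0 \<and> f = 0"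
proof -
  have "f = 0 \<or> degree ([:a:] + Y * f) = Suc (degree f)"
  proof (cases "f = 0")
    case False
    then have "degree (Y * f) = Suc (degree f)"
      by (simp add: Y_def degree_mult_eq del: mult_pCons_left)
    then show ?thesis
      by (simp add: degree_add_eq_right)
  qed simp
  then show "f \<in> V (k - 1)" and "k \<le> 0 \<Longrightarrow> a = 0 \<and> f = 0"
    using assms by (auto simp: V_degree)
qed

lemma degree_Y: "degree Y = 1" and degree_U: "degree U \<le> 2"
proof -
  show "degree Y = 1" by (simp add: Y_def)
  show "degree U \<le> 2"
    unfolding U2_def by (rule degree_smult_le [THEN order_trans]) (simp add: power2_eq_square degree_diff_le)
qed

text \<open>In \<open>S_YM\<close> the quadratic \<open>U\<close> multiplies \<open>D f\<close>,
  which lies two below the bound for \<open>Y * f\<close>, so the bound is preserved.\<close>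

lemma D_V: "f \<in> V k \<Longrightarrow> D f \<in> V (k - 1)" and S_V: "f \<in> V k \<Longrightarrow> S f \<in> V k"
proof -
  have "f \<in> V k \<longrightarrow> D f \<in> V (k - 1) \<and> S f \<in> V k"
  proof (induction f arbitrary: k rule: Y_induct)
    case 0
    show ?case by simp
  next
    case (step a f)
    show ?case
    proof
      assume *: "[:a:] + Y * f \<in> V k"
      show "D ([:a:] + Y * f) \<in> V (k - 1) \<and> S ([:a:] + Y * f) \<in> V k"
      proof (cases "k \<le> 0")
        case True
        then show ?thesis
          using V_step(2) [OF *] by simp
      next
        case False
        have Df: "D f \<in> V (k - 2)" and Sf: "S f \<in> V (k - 1)"
          using step V_step(1) [OF *] by fastforce+
        have "Y * D f \<in> V (k - 1)" "U * D f \<in> V k" "Y * S f \<in> V k" "[:a:] \<in> V k"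
          using V_mult [OF _ Df, of Y 1] V_mult [OF degree_U Df] V_mult [OF _ Sf, of Y 1] False
          by (simp_all add: degree_Y V_degree)
        with Sf show ?thesis
          by (simp add: D_add S_add D_YM S_YM V_add V_const_mult mult.assoc)
      qed
    qed
  qed
  then show "f \<in> V k \<Longrightarrow> D f \<in> V (k - 1)" "f \<in> V k \<Longrightarrow> S f \<in> V k"
    by blast+
qed

text \<open>The bounds say that the errors start two degrees below the leading term, one better than
  \<open>D_V\<close> and \<open>S_V\<close> would give. The reason is parity: \<open>U\<close> is
  even in \<open>Y\<close>, and \<open>D_YM\<close>, \<open>S_YM\<close> respect parity.\<close>

lemma D_S_power:
  "D (Y ^ m) - [:\<gamma> m:] * Y ^ (m - 1) \<in> V (int m - 2) \<and> S (Y ^ m) - [:\<alpha> m:] * Y ^ m \<in> V (int m - 1)"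
proof (induction m)
  case 0
  show ?case by (simp flip: one_pCons)
next
  case (Suc m)
  define E1 E2 where "E1 = D (Y ^ m) - [:\<gamma> m:] * Y ^ (m - 1)" and "E2 = S (Y ^ m) - [:\<alpha> m:] * Y ^ m"
  have E: "E1 \<in> V (int m - 2)" "E2 \<in> V (int m - 1)"
    using Suc by (simp_all add: E1_def E2_def)
  have DS: "D (Y ^ m) = [:\<gamma> m:] * Y ^ (m - 1) + E1" "S (Y ^ m) = [:\<alpha> m:] * Y ^ m + E2"
    by (simp_all add: E1_def E2_def)
  \<comment> \<open>For m = 0 the exponent m - 1 is truncated, but then the factor \<gamma> 0 is
    0.\<close>
  have Ym: "[:\<gamma> m:] * (Y * Y ^ (m - 1)) = [:\<gamma> m:] * Y ^ m"
    by (cases m) simp_all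
  have \<gamma>: "[:\<gamma> (Suc m):] = A * [:\<gamma> m:] + [:\<alpha> m:]"
    and \<alpha>: "[:\<alpha> (Suc m):] = A * [:\<alpha> m:] + (A\<^sup>2 - 1) * [:\<gamma> m:]"
    by (simp_all add: gamman_Suc [of m] alphan_Suc [of m] A_def power2_eq_square one_pCons)
  have UG: "U * ([:\<gamma> m:] * Y ^ (m - 1)) =
      (A\<^sup>2 - 1) * (Y * ([:\<gamma> m:] * Y ^ m) - [:4 * c1 * c2:] * ([:\<gamma> m:] * Y ^ (m - 1)))"
    unfolding U_eq Ym [symmetric] by (simp only: algebra_simps power2_eq_square)
  have "D (Y ^ Suc m) - [:\<gamma> (Suc m):] * Y ^ m = E2 + A * (Y * E1) + A * ([:\<gamma> m:] * (Y * Y ^ (m - 1)) - [:\<gamma> m:] * Y ^ m)"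
    unfolding power_Suc D_YM DS \<gamma> by (simp only: algebra_simps)
  then have "D (Y ^ Suc m) - [:\<gamma> (Suc m):] * Y ^ m = E2 + A * (Y * E1)"
    unfolding Ym by simp
  moreover have "S (Y ^ Suc m) - [:\<alpha> (Suc m):] * Y ^ Suc m =
      U * E1 + A * (Y * E2) + (U * ([:\<gamma> m:] * Y ^ (m - 1)) - (A\<^sup>2 - 1) * (Y * ([:\<gamma> m:] * Y ^ m)))"
    unfolding power_Suc S_YM DS \<alpha> by (simp only: algebra_simps)
  then have "S (Y ^ Suc m) - [:\<alpha> (Suc m):] * Y ^ Suc m =
      U * E1 + A * (Y * E2) - (A * (A * [:4 * c1 * c2:]) - [:4 * c1 * c2:]) * ([:\<gamma> m:] * Y ^ (m - 1))"
    unfolding UG by (simp add: algebra_simps power2_eq_square smult_diff_right)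
  moreover have "Y * E1 \<in> V (int m - 1)" "U * E1 \<in> V (int m)" "Y * E2 \<in> V (int m)"
    using V_mult [OF _ E(1), of Y 1] V_mult [OF degree_U E(1)] V_mult [OF _ E(2), of Y 1]
    by (simp_all add: degree_Y)
  moreover have "(A * (A * [:4 * c1 * c2:]) - [:4 * c1 * c2:]) * ([:\<gamma> m:] * Y ^ (m - 1)) \<in> V (int m)"
  proof (cases m)
    case (Suc l)
    have "Y ^ l \<in> V (int m)"
      using degree_power_le [of Y l] by (simp add: V_degree degree_Y Suc)
    then show ?thesis
      using Suc V_const_mult(1) [of "Y ^ l" "int m"] unfolding A_def by simp
  qed simp
  ultimately show ?case
    using E by (simp add: V_add V_diff V_const_mult)
qed

lemma power_Y_V: "Y ^ m \<in> V k" if "int m < k"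
  using degree_power_le [of Y m] that by (simp add: V_degree degree_Y)

lemma V_decomp:
  assumes "f \<in> V (int n + 1)" "degree g = n" "g \<noteq> 0"
  obtains c where "f - [:c:] * g \<in> V (int n)" "f \<notin> V (int n) \<Longrightarrow> c \<noteq> 0"
proof
  define c where "c = coeff f n / lead_coeff g"
  show "f - [:c:] * g \<in> V (int n)"
    unfolding V_def
  proof (clarify, goal_cases)
    case (1 i)
    show ?case
    proof (cases "i = n")
      case True
      then show ?thesis
        using assms leading_coeff_0_iff [of g] by (simp add: c_def)
    next
      case False
      with 1 have "n < i" by simp
      with assms show ?thesis
        by (simp add: V_def coeff_eq_0)
    qed
  qed
  then show "f \<notin> V (int n) \<Longrightarrow> c \<noteq> 0"
    by auto
qed

lemma Y_decomp:
  assumes "f \<in> V (int n + 1)"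
  obtains c where "f - [:c:] * Y ^ n \<in> V (int n)" "f \<notin> V (int n) \<Longrightarrow> c \<noteq> 0"
proof -
  have "degree (Y ^ n) = n" "Y ^ n \<noteq> 0"
    by (simp_all add: Y_def degree_linear_power)
  then show ?thesis
    using V_decomp [OF assms] that by metis
qed

lemma const_power_Y_in_V: "[:c:] * Y ^ n \<in> V (int n) \<Longrightarrow> c = 0"
proof -
  assume *: "[:c:] * Y ^ n \<in> V (int n)"
  have "coeff (Y ^ n) n = 1"
    using lead_coeff_power [of Y n] by (simp add: Y_def degree_linear_power)
  then have "coeff ([:c:] * Y ^ n) n = c"
    by simp
  with * show "c = 0"
    by (auto simp: V_def)
qed

lemma L_V: "L \<phi> \<psi> R \<in> V (k + 1)" if "degree \<phi> \<le> 2" "degree \<psi> \<le> 1" "R \<in> V k"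
  using V_mult [OF that(1) D_V [OF that(3)]] V_mult [OF that(2) S_V [OF that(3)]]
  by (simp add: L_def V_add add.commute)

lemma L_add: "L \<phi> \<psi> (f + g) = L \<phi> \<psi> f + L \<phi> \<psi> g"
  and L_const_mult: "L \<phi> \<psi> ([:a:] * f) = [:a:] * L \<phi> \<psi> f"
  unfolding L_def D_add S_add D_const_mult S_const_mult by (simp_all only: algebra_simps)

lemma degree_quadratic: "degree ([:a:] * Y\<^sup>2 + [:b:] * Y + [:c:]) \<le> 2"
  and degree_affine: "degree ([:d:] * Y + [:e:]) \<le> 1"
proof -
  show "degree ([:d:] * Y + [:e:]) \<le> 1"
    by (simp add: Y_def)
  show "degree ([:a:] * Y\<^sup>2 + [:b:] * Y + [:c:]) \<le> 2"
    unfolding Y_def by (intro degree_add_le) (auto simp: power2_eq_square)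
qed

text \<open>Since the errors in \<open>D_S_power\<close> start two degrees lower, neither they nor
  the constant term c reach the two top coefficients.\<close>

lemma L_power:
  fixes a b c d e :: complex and m :: nat
  defines "\<phi> \<equiv> [:a:] * Y\<^sup>2 + [:b:] * Y + [:c:]" and "\<psi> \<equiv> [:d:] * Y + [:e:]"
  shows "L \<phi> \<psi> (Y ^ m) - [:a * \<gamma> m + d * \<alpha> m:] * Y ^ Suc m - [:b * \<gamma> m + e * \<alpha> m:] * Y ^ m \<in> V (int m)"
proof -
  define E1 E2 where "E1 = D (Y ^ m) - [:\<gamma> m:] * Y ^ (m - 1)" and "E2 = S (Y ^ m) - [:\<alpha> m:] * Y ^ m"
  have E: "E1 \<in> V (int m - 2)" "E2 \<in> V (int m - 1)"
    using D_S_power by (simp_all add: E1_def E2_def)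
  have DS: "D (Y ^ m) = [:\<gamma> m:] * Y ^ (m - 1) + E1" "S (Y ^ m) = [:\<alpha> m:] * Y ^ m + E2"
    by (simp_all add: E1_def E2_def)
  have Ym: "Y * ([:\<gamma> m:] * Y ^ (m - 1)) = [:\<gamma> m:] * Y ^ m"
    by (cases m) simp_all
  have 1: "\<phi> * ([:\<gamma> m:] * Y ^ (m - 1)) =
      [:a * \<gamma> m:] * Y ^ Suc m + [:b * \<gamma> m:] * Y ^ m + [:c:] * ([:\<gamma> m:] * Y ^ (m - 1))"
  proof -
    have "\<phi> * ([:\<gamma> m:] * Y ^ (m - 1)) = [:a:] * (Y * (Y * ([:\<gamma> m:] * Y ^ (m - 1))))
        + [:b:] * (Y * ([:\<gamma> m:] * Y ^ (m - 1))) + [:c:] * ([:\<gamma> m:] * Y ^ (m - 1))"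
      unfolding \<phi>_def by (simp only: algebra_simps power2_eq_square)
    then show ?thesis
      unfolding Ym by (simp add: mult.commute [of a] mult.commute [of b])
  qed
  have 2: "\<psi> * ([:\<alpha> m:] * Y ^ m) = [:d * \<alpha> m:] * Y ^ Suc m + [:e * \<alpha> m:] * Y ^ m"
    unfolding \<psi>_def by (simp add: algebra_simps smult_add_right)
  have 3: "[:x + y:] = [:x:] + [:y:]" for x y :: complex
    by simp
  have "L \<phi> \<psi> (Y ^ m) - [:a * \<gamma> m + d * \<alpha> m:] * Y ^ Suc m - [:b * \<gamma> m + e * \<alpha> m:] * Y ^ m =
      \<phi> * E1 + \<psi> * E2 + [:c:] * ([:\<gamma> m:] * Y ^ (m - 1))"
    unfolding L_def DS distrib_left 1 2 3 by (simp only: algebra_simps)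
  moreover have "[:\<gamma> m:] * Y ^ (m - 1) \<in> V (int m)"
    by (cases m) (simp, intro V_const_mult power_Y_V, simp)
  moreover have "\<phi> * E1 \<in> V (int m)" "\<psi> * E2 \<in> V (int m)"
    using V_mult [OF degree_quadratic E(1)] V_mult [OF degree_affine E(2)] by (simp_all add: \<phi>_def \<psi>_def)
  ultimately show ?thesis
    by (simp add: V_add V_const_mult del: mult_pCons_left)
qed

text \<open>The second coefficient of the image collects the top term of \<open>L\<close> on the
  second term of \<open>R\<close> and the second term of \<open>L\<close> on the top one. The
  condition on r' is there because \<open>Y ^ (m - 1)\<close> is 1 for m = 0.\<close>

lemma L_lead:
  fixes a b c d e r r' :: complex and m :: nat
  defines "\<phi> \<equiv> [:a:] * Y\<^sup>2 + [:b:] * Y + [:c:]" and "\<psi> \<equiv> [:d:] * Y + [:e:]"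
  assumes R: "R - [:r:] * Y ^ m - [:r':] * Y ^ (m - 1) \<in> V (int m - 1)" and r': "m = 0 \<Longrightarrow> r' = 0"
  shows "L \<phi> \<psi> R - [:r * (a * \<gamma> m + d * \<alpha> m):] * Y ^ Suc m
    - [:r' * (a * \<gamma> (m - 1) + d * \<alpha> (m - 1)) + r * (b * \<gamma> m + e * \<alpha> m):] * Y ^ m \<in> V (int m)"
proof -
  define E where "E = R - [:r:] * Y ^ m - [:r':] * Y ^ (m - 1)"
  define F where "F k = L \<phi> \<psi> (Y ^ k) - [:a * \<gamma> k + d * \<alpha> k:] * Y ^ Suc k - [:b * \<gamma> k + e * \<alpha> k:] * Y ^ k" for k
  have F: "F k \<in> V (int k)" for k
    unfolding F_def \<phi>_def \<psi>_def by (rule L_power)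
  have LE: "L \<phi> \<psi> E \<in> V (int m)"
    using L_V [OF degree_quadratic degree_affine R] by (simp add: \<phi>_def \<psi>_def E_def)
  have Req: "R = E + ([:r:] * Y ^ m + [:r':] * Y ^ (m - 1))"
    by (simp add: E_def)
  have L_eq: "L \<phi> \<psi> (Y ^ k) = F k + [:a * \<gamma> k + d * \<alpha> k:] * Y ^ Suc k + [:b * \<gamma> k + e * \<alpha> k:] * Y ^ k" for k
    by (simp add: F_def)
  have split: "[:x + y:] = [:x:] + [:y:]" "[:x * y:] = [:x:] * [:y:]" for x y :: complex
    by simp_all
  have "[:r':] * L \<phi> \<psi> (Y ^ (m - 1)) - [:r' * (a * \<gamma> (m - 1) + d * \<alpha> (m - 1)):] * Y ^ m \<in> V (int m)"
  proof (cases m)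
    case 0
    then show ?thesis using r' by simp
  next
    case (Suc l)
    have "[:r':] * L \<phi> \<psi> (Y ^ (m - 1)) - [:r' * (a * \<gamma> (m - 1) + d * \<alpha> (m - 1)):] * Y ^ m =
        [:r':] * (F l + [:b * \<gamma> l + e * \<alpha> l:] * Y ^ l)"
      unfolding Suc diff_Suc_1 L_eq split(2) [of r'] by (simp only: algebra_simps)
    moreover have "F l + [:b * \<gamma> l + e * \<alpha> l:] * Y ^ l \<in> V (int m)"
      by (intro V_add V_const_mult power_Y_V V_mono [OF F]) (simp_all add: Suc)
    ultimately show ?thesis
      by (simp only: V_const_mult)
  qed
  then have "L \<phi> \<psi> E + [:r:] * F m + ([:r':] * L \<phi> \<psi> (Y ^ (m - 1)) - [:r' * (a * \<gamma> (m - 1) + d * \<alpha> (m - 1)):] * Y ^ m) \<in> V (int m)"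
    by (intro V_add V_const_mult F LE)
  moreover have "L \<phi> \<psi> R - [:r * (a * \<gamma> m + d * \<alpha> m):] * Y ^ Suc m
    - [:r' * (a * \<gamma> (m - 1) + d * \<alpha> (m - 1)) + r * (b * \<gamma> m + e * \<alpha> m):] * Y ^ m =
    L \<phi> \<psi> E + [:r:] * F m + ([:r':] * L \<phi> \<psi> (Y ^ (m - 1)) - [:r' * (a * \<gamma> (m - 1) + d * \<alpha> (m - 1)):] * Y ^ m)"
    unfolding Req L_add L_const_mult L_eq [of m] split(1) [of "r' * _"] split(2) [of r] by (simp only: algebra_simps)
  ultimately show ?thesis
    by simp
qed

section \<open>Orthogonal polynomial sequences\<close>

lemma OPS_orth:
  assumes u: "u \<in> poly_dual" and P: "is_OPS u P" and f: "f \<in> V (int n)"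
  shows "u (f * P n) = 0"
proof -
  have "f \<in> V (int k) \<Longrightarrow> k \<le> n \<Longrightarrow> u (f * P n) = 0" for k f
  proof (induction k arbitrary: f)
    case 0
    then have "f = 0" by (simp add: V_degree)
    then show ?case using poly_dual_0 [OF u] by simp
  next
    case (Suc k)
    have "P k \<noteq> 0"
      using P unfolding is_OPS_def by (metis mult_zero_left poly_dual_0 [OF u])
    moreover have "degree (P k) = k" "u (P k * P n) = 0"
      using P Suc.prems(2) by (auto simp: is_OPS_def)
    ultimately obtain c where "f - [:c:] * P k \<in> V (int k)"
      using V_decomp [of f k "P k"] Suc.prems(1) by (auto simp: add.commute)
    then have "u ((f - [:c:] * P k) * P n) = 0"
      using Suc by simp
    moreover have "u ((f - [:c:] * P k) * P n) = u (f * P n) - c * u (P k * P n)"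
      by (simp only: left_diff_distrib poly_dual_diff [OF u] mult.assoc poly_dual_const_mult [OF u])
    ultimately show ?case
      using \<open>u (P k * P n) = 0\<close> by simp
  qed
  then show ?thesis using f by blast
qed

text \<open>The Hankel matrix of order n is nonsingular. Testing \<open>f\<close> against the top
  \<open>P n\<close> shows that its coefficient along \<open>P n\<close> is 0, which lowers the
  degree bound.\<close>

lemma regular_nondegenerate:
  assumes u: "u \<in> poly_dual" and "regular u"
    and "f \<in> V (int n)" and "\<And>g. g \<in> V (int n) \<Longrightarrow> u (g * f) = 0"
  shows "f = 0"
proof -
  obtain P where P: "is_OPS u P"
    using assms(2) by (auto simp: regular_def)
  show ?thesis
    using assms(3,4)
  proof (induction n)
    case 0
    then show ?case by (simp add: V_degree)
  next
    case (Suc n)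
    have h: "u (P n * P n) \<noteq> 0" and deg: "degree (P n) = n"
      using P by (auto simp: is_OPS_def)
    then have "P n \<noteq> 0"
      using poly_dual_0 [OF u] by auto
    with deg obtain c where c: "f - [:c:] * P n \<in> V (int n)"
      using V_decomp [of f n "P n"] Suc.prems(1) by (auto simp: add.commute)
    have "P n \<in> V (int (Suc n))"
      by (simp add: V_degree deg)
    then have "0 = u (P n * f)"
      using Suc.prems(2) by simp
    also have "\<dots> = u ((f - [:c:] * P n) * P n) + c * u (P n * P n)"
      by (simp only: left_diff_distrib poly_dual_diff [OF u] mult.assoc poly_dual_const_mult [OF u] mult.commute [of "P n" f]) simp
    also have "u ((f - [:c:] * P n) * P n) = 0"
      by (rule OPS_orth [OF u P c])
    finally have "c = 0"
      using h by simp
    with c have "f \<in> V (int n)" by simp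
    then show ?case
    proof (rule Suc.IH)
      fix g assume "g \<in> V (int n)"
      then have "g \<in> V (int (Suc n))" by (rule V_mono) simp
      then show "u (g * f) = 0" by (rule Suc.prems(2))
    qed
  qed
qed

text \<open>\<open>D\<close> is onto: as \<gamma> (n + 1) is nonzero, \<open>D (Y ^ Suc n)\<close>
  has degree exactly n, so the moments of \<open>w\<close> vanish one after the other.\<close>

lemma poly_dual_eq_0_if_D:
  assumes w: "w \<in> poly_dual" and "\<And>f. w (D f) = 0"
  shows "w f = 0"
proof -
  have "f \<in> V (int n) \<Longrightarrow> w f = 0" for n f
  proof (induction n arbitrary: f)
    case 0
    then show ?case by (simp add: V_degree poly_dual_0 [OF w])
  next
    case (Suc n)
    then obtain c where c: "f - [:c:] * Y ^ n \<in> V (int n)"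
      using Y_decomp [of f n] by (auto simp: add.commute)
    define E where "E = D (Y ^ Suc n) - [:\<gamma> (Suc n):] * Y ^ n"
    have "E \<in> V (int n)"
      using D_S_power [of "Suc n"] by (auto simp: E_def elim: V_mono)
    then have "w E = 0" by (rule Suc.IH)
    then have "w (Y ^ n) = 0"
      unfolding E_def poly_dual_diff [OF w] poly_dual_const_mult [OF w] assms(2) by simp
    then show ?case
      using Suc.IH [OF c] by (simp only: poly_dual_diff [OF w] poly_dual_const_mult [OF w]) simp
  qed
  then show ?thesis
    using V_degree [of f "int (Suc (degree f))"] by fastforce
qed

text \<open>The symmetric q-factorial; it is the constant \<open>(D ^^ n) (Y ^ n)\<close>.\<close>

definition \<Gamma> :: "nat \<Rightarrow> complex" where "\<Gamma> n = (\<Prod>j=1..n. \<gamma> j)"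

lemma D_funpow_lead: "f - [:c:] * Y ^ n \<in> V (int n) \<Longrightarrow> (D ^^ n) f = [:c * \<Gamma> n:]"
proof (induction n arbitrary: f c)
  case 0
  then show ?case by (simp add: V_degree \<Gamma>_def)
next
  case (Suc n)
  have 1: "D (f - [:c:] * Y ^ Suc n) \<in> V (int n)"
    using D_V [OF Suc.prems] by simp
  have "D (Y ^ Suc n) - [:\<gamma> (Suc n):] * Y ^ n \<in> V (int n)"
    using D_S_power [of "Suc n"] by (auto elim: V_mono)
  then have "D (f - [:c:] * Y ^ Suc n) + [:c:] * (D (Y ^ Suc n) - [:\<gamma> (Suc n):] * Y ^ n) \<in> V (int n)"
    by (intro V_add V_const_mult 1)
  also have "D (f - [:c:] * Y ^ Suc n) + [:c:] * (D (Y ^ Suc n) - [:\<gamma> (Suc n):] * Y ^ n) = D f - [:c * \<gamma> (Suc n):] * Y ^ n"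
    unfolding D_diff D_const_mult by (simp add: algebra_simps smult_diff_right)
  finally have "(D ^^ n) (D f) = [:c * \<gamma> (Suc n) * \<Gamma> n:]"
    by (rule Suc.IH)
  then show ?case
    by (simp add: \<Gamma>_def funpow_swap1 mult_ac)
qed

lemma D_funpow_V: "f \<in> V (int n) \<Longrightarrow> (D ^^ n) f = 0"
  using D_funpow_lead [of f 0 n] by simp

lemma \<Gamma>_Suc: "\<Gamma> (Suc n) = \<gamma> (Suc n) * \<Gamma> n" and \<Gamma>_neq_0: "\<Gamma> n \<noteq> 0"
  by (simp_all add: \<Gamma>_def)

lemma dual_Dx_funpow: "(dual_Dx q c1 c2 c3 ^^ n) w f = (- 1) ^ n * w ((D ^^ n) f)"
proof (induction n arbitrary: f)
  case (Suc n)
  then show ?case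
    by (simp add: dual_Dx_def funpow_swap1 [of D] del: funpow.simps(2)) (simp add: dual_Dx_def funpow_swap1)
qed simp

text \<open>The relation cosh^2 - sinh^2 = 1: the index shift on the coefficient pairs has
  determinant 1 and can be undone.\<close>

lemma det_alphan_gamman: "(\<alpha> n)\<^sup>2 - ((alpha q)\<^sup>2 - 1) * (\<gamma> n)\<^sup>2 = 1"
proof (induction n)
  case (Suc n)
  then show ?case
    unfolding alphan_Suc gamman_Suc by algebra
qed simp

end

section \<open>Functionals satisfying the functional equation\<close>

locale pearson = q_lattice +
  fixes u :: "complex poly \<Rightarrow> complex" and \<phi> \<psi> :: "complex poly"
  assumes u: "u \<in> poly_dual" and u_neq_0: "u \<noteq> (\<lambda>f. 0)"
    and degree_\<phi>: "degree \<phi> \<le> 2" and degree_\<psi>: "degree \<psi> \<le> 1" and \<phi>\<psi>: "(\<phi>, \<psi>) \<noteq> (0, 0)"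
    and pearson: "dual_Dx q c1 c2 c3 (lmult \<phi> u) = dual_Sx q c1 c2 c3 (lmult \<psi> u)"
begin

abbreviation \<phi>n :: "nat \<Rightarrow> complex poly" where "\<phi>n \<equiv> phin q c1 c2 c3 \<phi> \<psi>"
abbreviation \<psi>n :: "nat \<Rightarrow> complex poly" where "\<psi>n \<equiv> psin q c3 \<phi> \<psi>"
abbreviation d :: "nat \<Rightarrow> complex" where "d \<equiv> dn q \<phi> \<psi>"
abbreviation e :: "nat \<Rightarrow> complex" where "e \<equiv> en q c3 \<phi> \<psi>"
abbreviation uk :: "nat \<Rightarrow> complex poly \<Rightarrow> complex" where "uk \<equiv> un q c1 c2 c3 \<phi> \<psi> u"

text \<open>\<open>an\<close> and \<open>bn\<close> are the partners of \<open>d\<close> and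
  \<open>e\<close>: a shift of the index acts on the pairs (\<open>an\<close>, \<open>d\<close>) and
  (\<open>bn\<close>, \<open>e\<close>) as a hyperbolic rotation. In \<phi>^[n] and \<psi>^[n] the
  first pair occurs at index 2n, the second at n.\<close>

definition an :: "nat \<Rightarrow> complex" where
  "an n = coeff \<psi> 1 * ((alpha q)\<^sup>2 - 1) * \<gamma> n + coeff \<phi> 2 * \<alpha> n"
definition bn :: "nat \<Rightarrow> complex" where
  "bn n = poly (pderiv \<phi>) c3 * \<alpha> n + poly \<psi> c3 * ((alpha q)\<^sup>2 - 1) * \<gamma> n"
definition \<phi>0 :: complex where "\<phi>0 = poly \<phi> c3 + 2 * coeff \<phi> 2 * c1 * c2"

lemma \<phi>n_eq: "\<phi>n n = [:an (2 * n):] * (Y\<^sup>2 - [:2 * c1 * c2:]) + [:bn n:] * Y + [:\<phi>0:]"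
  and \<psi>n_eq: "\<psi>n n = [:d (2 * n):] * Y + [:e n:]"
  by (simp_all add: phin_def psin_def an_def bn_def \<phi>0_def dn_def en_def Y_def)

lemma \<phi>n_quadratic: "\<phi>n n = [:an (2 * n):] * Y\<^sup>2 + [:bn n:] * Y + [:\<phi>0 - an (2 * n) * (2 * c1 * c2):]"
  by (simp add: \<phi>n_eq algebra_simps smult_diff_right)

text \<open>The left-hand sides of the first two are the coefficients that \<open>L_power\<close>
  produces from \<open>Y ^ m\<close>; so applying \<open>L\<close> to a power of degree m shifts the
  index by m.\<close>

lemma dn_add: "an k * \<gamma> m + d k * \<alpha> m = d (m + k)"
  and en_add: "bn k * \<gamma> m + e k * \<alpha> m = e (m + k)"
  and an_add: "an (m + k) = an k * \<alpha> m + d k * ((alpha q)\<^sup>2 - 1) * \<gamma> m"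
  and bn_add: "bn (m + k) = bn k * \<alpha> m + e k * ((alpha q)\<^sup>2 - 1) * \<gamma> m"
  unfolding an_def bn_def dn_def en_def gamman_add alphan_add by (simp_all add: algebra_simps)

lemma gamman_2: "\<gamma> 2 = 2 * alpha q" and alphan_2: "\<alpha> 2 = 2 * (alpha q)\<^sup>2 - 1"
  using gamman_add [of 1 1] alphan_add [of 1 1] by (simp_all add: numeral_2_eq_2 power2_eq_square algebra_simps)

text \<open>\<open>S\<close> multiplies \<open>Y\<^sup>2 - [:2 * c1 * c2:]\<close> by \<alpha> 2,
  and \<open>U1 * S Y + A * U * D Y\<close> is a multiple of the same polynomial. This is the origin
  of the constant 2 c1 c2, the reason why \<open>\<phi>0\<close> does not depend on n, and why the
  leading pair advances by two indices per step while the middle pair advances by one.\<close>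

lemma \<phi>n_Suc: "\<phi>n (Suc n) = S (\<phi>n n) + U1 * S (\<psi>n n) + A * U * D (\<psi>n n)"
proof -
  have "an (2 * Suc n) = an (2 * n) * (2 * (alpha q)\<^sup>2 - 1) + d (2 * n) * ((alpha q)\<^sup>2 - 1) * (2 * alpha q)"
    using an_add [of 2 "2 * n"] by (simp add: gamman_2 alphan_2)
  then have a: "[:an (2 * Suc n):] = [:an (2 * n):] * (2 * A\<^sup>2 - 1) + [:d (2 * n):] * (A\<^sup>2 - 1) * (2 * A)"
    by (simp add: A_def power2_eq_square one_pCons numeral_poly)
  have "bn (Suc n) = bn n * alpha q + e n * ((alpha q)\<^sup>2 - 1)"
    using bn_add [of 1 n] by simp
  then have b: "[:bn (Suc n):] = [:bn n:] * A + [:e n:] * (A\<^sup>2 - 1)"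
    by (simp add: A_def power2_eq_square one_pCons)
  define K where "K = [:2 * c1 * c2:]"
  have K: "[:4 * c1 * c2:] = 2 * K"
    by (simp add: K_def numeral_poly)
  have SY2: "S (Y\<^sup>2) = U + A\<^sup>2 * Y\<^sup>2"
    unfolding power2_eq_square S_mult D_Y S_Y by (simp add: algebra_simps)
  show ?thesis
    unfolding \<phi>n_eq \<psi>n_eq a b D_add S_add S_diff D_const_mult S_const_mult D_Y S_Y D_const S_const SY2 U_eq K
    unfolding K_def [symmetric]
    by (simp only: algebra_simps power2_eq_square mult_2 mult_2_right mult_1_left mult_1_right mult_zero_left mult_zero_right)
qed

lemma \<psi>n_Suc: "\<psi>n (Suc n) = D (\<phi>n n) + A * S (\<psi>n n) + U1 * D (\<psi>n n)"
proof -
  have "d (2 * Suc n) = an (2 * n) * (2 * alpha q) + d (2 * n) * (2 * (alpha q)\<^sup>2 - 1)"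
    using dn_add [of "2 * n" 2] by (simp add: gamman_2 alphan_2)
  then have a: "[:d (2 * Suc n):] = [:an (2 * n):] * (2 * A) + [:d (2 * n):] * (2 * A\<^sup>2 - 1)"
    by (simp add: A_def power2_eq_square one_pCons numeral_poly)
  have "e (Suc n) = bn n + e n * alpha q"
    using en_add [of n 1] by simp
  then have b: "[:e (Suc n):] = [:bn n:] + [:e n:] * A"
    by (simp add: A_def)
  have DY2: "D (Y\<^sup>2) = 2 * A * Y"
    unfolding power2_eq_square D_mult D_Y S_Y by (simp add: algebra_simps)
  show ?thesis
    unfolding \<phi>n_eq \<psi>n_eq a b D_add S_add D_diff D_const_mult S_const_mult D_Y S_Y D_const S_const DY2
    by (simp only: algebra_simps power2_eq_square mult_2 mult_2_right mult_1_left mult_1_right mult_zero_left mult_zero_right)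
qed

lemma \<phi>_eq: "\<phi> = [:coeff \<phi> 0, coeff \<phi> 1, coeff \<phi> 2:]"
proof (rule poly_eqI)
  fix i
  have "i = 0 \<or> i = 1 \<or> i = 2 \<or> degree \<phi> < i" using degree_\<phi> by linarith
  then show "coeff \<phi> i = coeff [:coeff \<phi> 0, coeff \<phi> 1, coeff \<phi> 2:] i"
    by (auto simp: coeff_eq_0 numeral_2_eq_2 coeff_pCons split: nat.splits)
qed

lemma \<psi>_eq: "\<psi> = [:coeff \<psi> 0, coeff \<psi> 1:]"
proof (rule poly_eqI)
  fix i
  have "i = 0 \<or> i = 1 \<or> degree \<psi> < i" using degree_\<psi> by linarith
  then show "coeff \<psi> i = coeff [:coeff \<psi> 0, coeff \<psi> 1:] i"
    by (auto simp: coeff_eq_0 coeff_pCons split: nat.splits)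
qed

lemma \<phi>n_0: "\<phi>n 0 = \<phi>"
proof -
  obtain a b c where "\<phi> = [:c, b, a:]"
    using \<phi>_eq by blast
  then show ?thesis
    by (simp add: phin_def pderiv_pCons numeral_2_eq_2 power2_eq_square algebra_simps)
qed

lemma \<psi>n_0: "\<psi>n 0 = \<psi>"
proof -
  obtain a b where "\<psi> = [:b, a:]"
    using \<psi>_eq by blast
  then show ?thesis
    by (simp add: psin_def algebra_simps)
qed

lemma x_admissible_iff: "x_admissible q \<phi> \<psi> \<longleftrightarrow> (\<forall>n. d n \<noteq> 0)"
proof -
  have "smult (\<gamma> n / 2) (pderiv (pderiv \<phi>)) + smult (\<alpha> n) (pderiv \<psi>) = [:d n:]" for n
    by (subst \<phi>_eq, subst \<psi>_eq) (simp add: pderiv_pCons dn_def)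
  then show ?thesis
    by (simp add: x_admissible_def)
qed

section \<open>The functionals u^[k] and their iterated images under \<open>dual_Dx\<close>\<close>

lemma uk_Suc: "uk (Suc k) f = - uk k (U * \<psi>n k * D f + \<phi>n k * S f)"
  if "uk k \<in> poly_dual"
  by (simp add: dual_Dx_def dual_Sx_def lmult_def poly_dual_add [OF that] mult_ac)

lemma uk_dual: "uk k \<in> poly_dual"
proof (induction k)
  case 0
  show ?case by (simp add: u)
next
  case (Suc k)
  have "D (smult c f) = smult c (D f)" "S (smult c f) = smult c (S f)" for c f
    using D_const_mult [of c f] S_const_mult [of c f] by simp_all
  then have "U * \<psi>n k * D (smult c f) + \<phi>n k * S (smult c f) = smult c (U * \<psi>n k * D f + \<phi>n k * S f)" for c f
    by (simp add: smult_add_right)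
  moreover have "U * \<psi>n k * D (f + g) + \<phi>n k * S (f + g) =
    (U * \<psi>n k * D f + \<phi>n k * S f) + (U * \<psi>n k * D g + \<phi>n k * S g)" for f g
    by (simp add: D_add S_add algebra_simps)
  ultimately show ?case
    by (intro poly_dualI) (simp_all only: uk_Suc [OF Suc] poly_dual_add [OF Suc] poly_dual_smult [OF Suc] algebra_simps minus_add_distrib mult_minus_right)
qed

lemmas uk_Suc' = uk_Suc [OF uk_dual]
lemmas uk_add = poly_dual_add [OF uk_dual] and uk_diff = poly_dual_diff [OF uk_dual]
  and uk_const_mult = poly_dual_const_mult [OF uk_dual] and uk_0 = poly_dual_0 [OF uk_dual]

lemma uk_A: "uk k (A * f) = alpha q * uk k f"
  unfolding A_def by (rule uk_const_mult)

lemma uk_pearson: "uk k (L (\<phi>n k) (\<psi>n k) f) = 0"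
proof (induction k arbitrary: f)
  case 0
  have "- u (D f * \<phi>) = u (S f * \<psi>)"
    using fun_cong [OF pearson, of f] by (simp add: dual_Dx_def dual_Sx_def lmult_def)
  then show ?case
    unfolding un.simps L_def \<phi>n_0 \<psi>n_0 poly_dual_add [OF u] by (metis add.right_inverse mult.commute)
next
  case (Suc k)
  show ?case
    unfolding \<phi>n_Suc \<psi>n_Suc uk_Suc' pearson_step_identity Suc.IH by simp
qed

lemma uk_Suc_L: "uk (Suc k) (R * D f) = alpha q * uk k (L (\<phi>n k) (\<psi>n k) R * f)"
proof -
  have "U * \<psi>n k * D (R * D f) + \<phi>n k * S (R * D f) =
    L (\<phi>n k) (\<psi>n k) (R * (A * S f - U1 * D f)) - A * (L (\<phi>n k) (\<psi>n k) R * f)"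
    unfolding L_test [symmetric] by simp
  then show ?thesis
    unfolding uk_Suc' by (simp only: uk_diff uk_pearson uk_A) simp
qed

text \<open>This merges the two contributions to the second coefficient in
  \<open>iterated_rodrigues\<close> into one. Both sides are linear in \<open>an t\<close> and
  \<open>d t\<close>; the coefficients of \<open>an t\<close> agree, and those of \<open>d t\<close>
  agree by \<gamma> (l + 1) + \<alpha> (l + 2) = \<alpha> 1 * \<gamma> (l + 2).\<close>

lemma gamman_dn: "\<gamma> (Suc l) * d t + d (t + Suc (Suc l)) = \<gamma> (Suc (Suc l)) * d (Suc t)"
proof -
  have "\<gamma> (Suc l) + \<alpha> (Suc (Suc l)) = \<gamma> (Suc (Suc l)) * alpha q"
    unfolding gamman_Suc [of "Suc l"] alphan_Suc [of "Suc l"] by algebra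
  then show ?thesis
    using dn_add [of t 1] dn_add [of t "Suc (Suc l)"] by (simp add: add.commute) algebra
qed

text \<open>The ratio \<open>r' / r\<close> is stated as a product, since \<open>d\<close> may vanish here.\<close>

lemma iterated_rodrigues:
  obtains X r r' where "\<And>f. (dual_Dx q c1 c2 c3 ^^ m) (uk (k + m)) f = uk k (f * X)"
    and "X - [:r:] * Y ^ m - [:r':] * Y ^ (m - 1) \<in> V (int m - 1)"
    and "r = (- alpha q) ^ m * (\<Prod>j<m. d (2 * k + m - 1 + j))"
    and "m = 0 \<Longrightarrow> r' = 0"
    and "m > 0 \<Longrightarrow> r' * d (2 * k + 2 * m - 2) = \<gamma> m * e (k + m - 1) * r"
proof (induction m arbitrary: k thesis)
  case 0
  show ?case
    by (rule 0 [of 1 1 0]) (simp_all flip: one_pCons)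
next
  case (Suc m)
  \<comment> \<open>The outermost \<open>dual_Dx\<close> is peeled off. The inner m-fold image of
    u^[k + m + 1] is the case m of the claim for start index \<open>Suc k\<close>, which is why k is
    arbitrary.\<close>
  obtain X r r' where X: "\<And>f. (dual_Dx q c1 c2 c3 ^^ m) (uk (Suc k + m)) f = uk (Suc k) (f * X)"
    "X - [:r:] * Y ^ m - [:r':] * Y ^ (m - 1) \<in> V (int m - 1)"
    and r: "r = (- alpha q) ^ m * (\<Prod>j<m. d (2 * Suc k + m - 1 + j))"
    and r': "m = 0 \<Longrightarrow> r' = 0"
     "m > 0 \<Longrightarrow> r' * d (2 * Suc k + 2 * m - 2) = \<gamma> m * e (Suc k + m - 1) * r"
    using Suc.IH by blast
  define X' where "X' = [:- alpha q:] * L (\<phi>n k) (\<psi>n k) X"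
  define s s' where "s = r * d (m + 2 * k)" and "s' = r' * d (m - 1 + 2 * k) + r * e (m + k)"
  have X': "L (\<phi>n k) (\<psi>n k) X - [:s:] * Y ^ Suc m - [:s':] * Y ^ m \<in> V (int m)"
    unfolding \<phi>n_quadratic \<psi>n_eq s_def s'_def dn_add [symmetric] en_add [symmetric] by (rule L_lead [OF X(2) r'(1)])
  show ?case
  proof (rule Suc.prems [of X' "- alpha q * s" "- alpha q * s'"])
    fix f
    have "(dual_Dx q c1 c2 c3 ^^ Suc m) (uk (k + Suc m)) f = - uk (Suc k) (X * D f)"
      using X(1) by (simp add: dual_Dx_def mult.commute)
    also have "\<dots> = uk k ([:- alpha q:] * (L (\<phi>n k) (\<psi>n k) X * f))"
      unfolding uk_Suc_L uk_const_mult by simp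
    also have "[:- alpha q:] * (L (\<phi>n k) (\<psi>n k) X * f) = f * X'"
      unfolding X'_def by (simp only: mult_ac)
    finally show "(dual_Dx q c1 c2 c3 ^^ Suc m) (uk (k + Suc m)) f = uk k (f * X')" .
  next
    have "[:- alpha q:] * (L (\<phi>n k) (\<psi>n k) X - [:s:] * Y ^ Suc m - [:s':] * Y ^ m) \<in> V (int m)"
      by (rule V_const_mult(1) [OF X'])
    also have "[:- alpha q:] * (L (\<phi>n k) (\<psi>n k) X - [:s:] * Y ^ Suc m - [:s':] * Y ^ m) =
      X' - [:- alpha q * s:] * Y ^ Suc m - [:- alpha q * s':] * Y ^ (Suc m - 1)"
      by (simp add: X'_def algebra_simps smult_diff_right smult_add_right)
    finally show "X' - [:- alpha q * s:] * Y ^ Suc m - [:- alpha q * s':] * Y ^ (Suc m - 1) \<in> V (int (Suc m) - 1)"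
      by simp
  next
    have "(\<Prod>j<Suc m. d (2 * k + m + j)) = d (2 * k + m) * (\<Prod>j<m. d (2 * Suc k + m - 1 + j))"
      unfolding prod.lessThan_Suc_shift by simp
    then show "- alpha q * s = (- alpha q) ^ Suc m * (\<Prod>j<Suc m. d (2 * k + Suc m - 1 + j))"
      by (simp add: s_def r add.commute)
  next
    have "s' * d (2 * k + 2 * m) = \<gamma> (Suc m) * e (k + m) * s"
    proof (cases m)
      case 0
      then show ?thesis using r'(1) by (simp add: s_def s'_def)
    next
      case (Suc l)
      have "s' * d (2 * k + 2 * m) = (r' * d (2 * k + 2 * m)) * d (l + 2 * k) + r * e (m + k) * d (2 * k + 2 * m)"
        by (simp add: s'_def Suc algebra_simps)
      also have "r' * d (2 * k + 2 * m) = \<gamma> m * e (k + m) * r"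
        using r'(2) Suc by simp
      also have "\<gamma> m * e (k + m) * r * d (l + 2 * k) + r * e (m + k) * d (2 * k + 2 * m) =
        r * e (k + m) * (\<gamma> (Suc l) * d (l + 2 * k) + d (l + 2 * k + Suc (Suc l)))"
      proof -
        have "2 * k + 2 * m = l + 2 * k + Suc (Suc l)" using Suc by simp
        then show ?thesis by (simp add: Suc algebra_simps)
      qed
      also have "\<dots> = \<gamma> (Suc m) * e (k + m) * s"
        unfolding gamman_dn by (simp add: s_def Suc algebra_simps)
      finally show ?thesis .
    qed
    then show "- alpha q * s' * d (2 * k + 2 * Suc m - 2) = \<gamma> (Suc m) * e (k + Suc m - 1) * (- alpha q * s)"
      by simp
  qed simp
qed

section \<open>Regularity forces d_n to be nonzero\<close>

lemma D_funpow_eq_0: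
  assumes "w \<in> poly_dual" and "\<And>f. w ((D ^^ n) f) = 0"
  shows "w f = 0"
  using assms(2)
proof (induction n arbitrary: f)
  case (Suc n)
  have "w ((D ^^ n) f) = 0" for f
  proof -
    have "(\<lambda>f. w ((D ^^ n) f)) \<in> poly_dual"
    proof (rule poly_dualI)
      have add: "(D ^^ n) (f + g) = (D ^^ n) f + (D ^^ n) g" for f g
        by (induction n) (simp_all add: D_add)
      have sm: "(D ^^ n) (smult c f) = smult c ((D ^^ n) f)" for c f
      proof (induction n)
        case (Suc n)
        then show ?case using D_const_mult [of c "(D ^^ n) f"] by simp
      qed simp
      show "w ((D ^^ n) (f + g)) = w ((D ^^ n) f) + w ((D ^^ n) g)" for f g
        by (simp add: add poly_dual_add [OF assms(1)])
      show "w ((D ^^ n) (smult c f)) = c * w ((D ^^ n) f)" for c f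
        by (simp add: sm poly_dual_smult [OF assms(1)])
    qed
    moreover have "w ((D ^^ n) (D f)) = 0" for f
      using Suc.prems [of f] by (simp add: funpow_swap1)
    ultimately show ?thesis
      by (rule poly_dual_eq_0_if_D)
  qed
  then show ?case by (rule Suc.IH)
qed simp

text \<open>The two zeros give \<open>an n = 0\<close> as well, and the rotation of determinant 1
  that takes (a, d) to (\<open>an n\<close>, \<open>d n\<close>) is inverted.\<close>

lemma consecutive_dn_eq_0: "coeff \<phi> 2 = 0 \<and> coeff \<psi> 1 = 0" if "d n = 0" "d (Suc n) = 0"
proof -
  have dn: "d n = 0" "an n = 0"
    using that dn_add [of n 1] by simp_all
  have "coeff \<phi> 2 = \<alpha> n * an n - ((alpha q)\<^sup>2 - 1) * \<gamma> n * d n"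
    and "coeff \<psi> 1 = \<alpha> n * d n - \<gamma> n * an n"
    using det_alphan_gamman [of n] unfolding an_def dn_def by algebra+
  with dn show ?thesis by simp
qed

text \<open>For a multiple R of \<pi>, \<open>uk_Suc_L\<close> shows that \<open>L R\<close>
  annihilates \<open>uk k\<close>. It is nonzero if d at degree R + 2k is nonzero, this being the
  factor in its leading coefficient; if that fails for R = \<pi>, it holds for R = \<pi> *
  Y.\<close>

lemma annihilator_descent:
  assumes "\<pi> \<noteq> 0" and "\<And>f. uk (Suc k) (f * \<pi>) = 0" and "\<not> (coeff \<phi> 2 = 0 \<and> coeff \<psi> 1 = 0)"
  obtains \<pi>' where "\<pi>' \<noteq> 0" "\<And>f. uk k (f * \<pi>') = 0"
proof -
  note witness = that
  have step: thesis if R: "R = \<pi> * g" "R \<noteq> 0" "d (degree R + 2 * k) \<noteq> 0" for R g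
  proof (rule witness)
    fix f
    have "alpha q * uk k (L (\<phi>n k) (\<psi>n k) R * f) = 0"
      unfolding uk_Suc_L [symmetric] using assms(2) [of "g * D f"] by (simp add: R(1) mult_ac)
    then show "uk k (f * L (\<phi>n k) (\<psi>n k) R) = 0"
      using alpha_neq_0 by (simp add: mult.commute)
  next
    define m where "m = degree R"
    have "R \<in> V (int m + 1)" "R \<notin> V (int m)"
      using R(2) by (simp_all add: V_degree m_def)
    then obtain c where c: "R - [:c:] * Y ^ m \<in> V (int m)" "c \<noteq> 0"
      by (metis Y_decomp)
    obtain c' where c': "R - [:c:] * Y ^ m - [:c':] * Y ^ (m - 1) \<in> V (int m - 1)" "m = 0 \<Longrightarrow> c' = 0"
    proof (cases m)
      case 0
      then show ?thesis using c that [of 0] by (simp add: V_degree)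
    next
      case (Suc l)
      then show ?thesis
        using c that Y_decomp [of "R - [:c:] * Y ^ m" l] by (auto simp: add.commute)
    qed
    define t where "t = c' * (an (2 * k) * \<gamma> (m - 1) + d (2 * k) * \<alpha> (m - 1)) + c * (bn k * \<gamma> m + e k * \<alpha> m)"
    have "L (\<phi>n k) (\<psi>n k) R - [:c * d (m + 2 * k):] * Y ^ Suc m - [:t:] * Y ^ m \<in> V (int m)"
      unfolding t_def dn_add [symmetric] \<phi>n_quadratic \<psi>n_eq by (rule L_lead [OF c'])
    then have *: "L (\<phi>n k) (\<psi>n k) R - [:c * d (m + 2 * k):] * Y ^ Suc m - [:t:] * Y ^ m \<in> V (int (Suc m))"
      by (rule V_mono) simp
    have shift: "0 - (- x - y) - y = x" for x y :: "complex poly"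
      by simp
    show "L (\<phi>n k) (\<psi>n k) R \<noteq> 0"
    proof
      assume "L (\<phi>n k) (\<psi>n k) R = 0"
      with * have **: "- ([:c * d (m + 2 * k):] * Y ^ Suc m) - [:t:] * Y ^ m \<in> V (int (Suc m))"
        by simp
      have "0 - (- ([:c * d (m + 2 * k):] * Y ^ Suc m) - [:t:] * Y ^ m) - [:t:] * Y ^ m \<in> V (int (Suc m))"
        by (intro V_diff V_const_mult power_Y_V V_0 **) simp
      then have "[:c * d (m + 2 * k):] * Y ^ Suc m \<in> V (int (Suc m))"
        by (simp only: shift)
      then have "c * d (m + 2 * k) = 0"
        by (rule const_power_Y_in_V)
      with c(2) R(3) show False by (simp add: m_def)
    qed
  qed
  show thesis
  proof (cases "d (degree \<pi> + 2 * k) = 0")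
    case False
    then show thesis using step [of \<pi> 1] assms(1) by simp
  next
    case True
    then have "d (Suc (degree \<pi> + 2 * k)) \<noteq> 0"
      using consecutive_dn_eq_0 assms(3) by blast
    moreover have "\<pi> * Y \<noteq> 0" "degree (\<pi> * Y) = Suc (degree \<pi>)"
      using assms(1) by (simp_all add: Y_def degree_mult_eq del: mult_pCons_right)
    ultimately show thesis using step [of "\<pi> * Y" Y] by simp
  qed
qed

lemma regular_dn_neq_0:
  assumes "regular u"
  shows "d n \<noteq> 0"
proof
  assume dn: "d n = 0"
  note nondeg = regular_nondegenerate [OF u assms]
  have no_annihilator: "\<pi> = 0" if "\<And>f. uk 0 (f * \<pi>) = 0" for \<pi>
    using nondeg [of \<pi> "Suc (degree \<pi>)"] that by (simp add: V_degree)
  have leading: "coeff \<phi> 2 = 0 \<and> coeff \<psi> 1 = 0"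
  proof (rule ccontr)
    assume ad: "\<not> (coeff \<phi> 2 = 0 \<and> coeff \<psi> 1 = 0)"
    obtain X r r' where X: "\<And>f. (dual_Dx q c1 c2 c3 ^^ Suc n) (uk (0 + Suc n)) f = uk 0 (f * X)"
      "X - [:r:] * Y ^ Suc n - [:r':] * Y ^ (Suc n - 1) \<in> V (int (Suc n) - 1)"
      "r = (- alpha q) ^ Suc n * (\<Prod>j<Suc n. d (2 * 0 + Suc n - 1 + j))"
      using iterated_rodrigues [of "Suc n" 0] by metis
    \<comment> \<open>The factor for j = 0 of the product is \<open>d n\<close>.\<close>
    have "r = 0"
      using X(3) dn by (simp add: prod.lessThan_Suc_shift del: prod.lessThan_Suc)
    have "(X - [:r:] * Y ^ Suc n - [:r':] * Y ^ (Suc n - 1)) - [:- r':] * Y ^ n \<in> V (int (Suc n))"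
      by (intro V_diff V_const_mult power_Y_V V_mono [OF X(2)]) simp_all
    then have "X \<in> V (int (Suc n))"
      by (simp add: \<open>r = 0\<close>)
    moreover have "u (f * X) = 0" if "f \<in> V (int (Suc n))" for f
      using X(1) [of f] unfolding dual_Dx_funpow D_funpow_V [OF that] uk_0 by simp
    ultimately have "X = 0"
      by (rule nondeg)
    then have "uk (Suc n) ((D ^^ Suc n) f) = 0" for f
      using X(1) [of f] unfolding dual_Dx_funpow \<open>X = 0\<close> mult_zero_right uk_0 by simp
    then have "uk (Suc n) f = 0" for f
      by (rule D_funpow_eq_0 [OF uk_dual])
    then have "\<exists>\<pi>. \<pi> \<noteq> 0 \<and> (\<forall>f. uk (Suc n) (f * \<pi>) = 0)"
      by (intro exI [of _ 1]) simp
    moreover have "\<exists>\<pi>. \<pi> \<noteq> 0 \<and> (\<forall>f. uk 0 (f * \<pi>) = 0)" if "\<exists>\<pi>. \<pi> \<noteq> 0 \<and> (\<forall>f. uk k (f * \<pi>) = 0)" for k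
      using that
    proof (induction k)
      case (Suc k)
      then show ?case
        by (metis annihilator_descent [OF _ _ ad])
    qed
    ultimately show False
      using no_annihilator by blast
  qed
  \<comment> \<open>Remaining case: \<psi> is a constant. Testing the functional equation on 1 gives
    \<open>u \<psi> = 0\<close>, and \<open>u 1\<close> is nonzero by regularity, so \<psi> = 0.
    Then \<phi> u vanishes on the range of \<open>D\<close>, hence is 0, and \<phi> = 0
    follows.\<close>
  define \<epsilon> where "\<epsilon> = coeff \<psi> 0"
  have \<psi>: "\<psi> = [:\<epsilon>:]"
  proof (rule poly_eqI)
    fix i show "coeff \<psi> i = coeff [:\<epsilon>:] i"
      using leading degree_\<psi> by (cases "i = 0"; cases "i = 1") (auto simp: \<epsilon>_def coeff_pCons coeff_eq_0 split: nat.splits)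
  qed
  have "u \<psi> = 0"
    using uk_pearson [of 0 1] by (simp add: L_def \<phi>n_0 \<psi>n_0)
  then have "u ([:\<epsilon>:] * 1) = 0"
    by (simp add: \<psi>)
  then have "\<epsilon> * u 1 = 0"
    unfolding poly_dual_const_mult [OF u] .
  moreover have "u 1 \<noteq> 0"
  proof
    assume *: "u 1 = 0"
    have "(1 :: complex poly) = 0"
    proof (rule nondeg [of 1 1])
      fix g :: "complex poly" assume "g \<in> V (int 1)"
      then obtain c where "g = [:c:] * 1"
        by (auto simp: V_degree elim: degree_eq_zeroE)
      then show "u (g * 1) = 0"
        using poly_dual_const_mult [OF u, of c 1] * by simp
    qed (simp add: V_degree)
    then show False by simp
  qed
  ultimately have "\<psi> = 0"
    by (simp add: \<psi>)
  have "u (f * \<phi>) = 0" for f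
  proof (rule poly_dual_eq_0_if_D [of "\<lambda>f. u (f * \<phi>)"])
    show "(\<lambda>f. u (f * \<phi>)) \<in> poly_dual"
      by (rule poly_dualI) (simp_all add: distrib_right poly_dual_add [OF u] poly_dual_smult [OF u])
    show "u (D f * \<phi>) = 0" for f
      using uk_pearson [of 0 f] unfolding \<phi>n_0 \<psi>n_0 by (simp add: L_def \<open>\<psi> = 0\<close> mult.commute)
  qed
  then have "\<phi> = 0"
    using no_annihilator [of \<phi>] by simp
  with \<open>\<psi> = 0\<close> \<phi>\<psi> show False by simp
qed

section \<open>The values u^[n](1) and the squared norms\<close>

definition \<Phi> :: "nat \<Rightarrow> complex" where "\<Phi> n = poly (\<phi>n n) (c3 - e n / d (2 * n))"

lemma \<psi>n_dvd_iff: "\<psi>n n dvd \<phi>n n \<longleftrightarrow> \<Phi> n = 0" if "d (2 * n) \<noteq> 0"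
proof -
  have "\<psi>n n = smult (d (2 * n)) [:- (c3 - e n / d (2 * n)), 1:]"
    using that by (simp add: \<psi>n_eq Y_def algebra_simps)
  then have "\<psi>n n dvd \<phi>n n \<longleftrightarrow> [:- (c3 - e n / d (2 * n)), 1:] dvd \<phi>n n"
    using that by (simp only: smult_dvd_iff) simp
  then show ?thesis
    by (simp only: poly_eq_0_iff_dvd \<Phi>_def)
qed

text \<open>The functional equation on 1 and on \<open>Y\<close> expresses the first two moments of
  u^[n] by u^[n](1); solving for the second brings in the factor a + \<alpha> 1 * d (2n) = d (2n +
  1). Inserted into -u^[n](\<phi>^[n]) they give a e^2 - b e d + c d^2, which is d^2 times
  \<phi>^[n] at the zero of \<psi>^[n].\<close>

lemma uk_1_Suc:
  assumes "d (2 * n) \<noteq> 0" and "d (Suc (2 * n)) \<noteq> 0"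
  shows "uk (Suc n) 1 * d (Suc (2 * n)) = - alpha q * d (2 * n) * \<Phi> n * uk n 1"
proof -
  define a b c where "a = an (2 * n)" and "b = bn n" and "c = \<phi>0 - an (2 * n) * (2 * c1 * c2)"
  have \<phi>: "\<phi>n n = [:a:] * Y\<^sup>2 + [:b:] * Y + [:c:]"
    unfolding \<phi>n_quadratic a_def b_def c_def ..
  have d1: "d (Suc (2 * n)) = a + alpha q * d (2 * n)"
    using dn_add [of "2 * n" 1] by (simp add: a_def mult.commute)
  define w0 w1 w2 where "w0 = uk n 1" and "w1 = uk n Y" and "w2 = uk n (Y\<^sup>2)"
  have const: "uk n [:k:] = k * w0" for k
    using uk_const_mult [of n k 1] by (simp add: w0_def)
  have "uk n (\<psi>n n) = 0"
    using uk_pearson [of n 1] by (simp add: L_def)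
  then have 1: "d (2 * n) * w1 + e n * w0 = 0"
    unfolding \<psi>n_eq uk_add uk_const_mult const w1_def .
  have "L (\<phi>n n) (\<psi>n n) Y = \<phi>n n + A * ([:d (2 * n):] * Y\<^sup>2 + [:e n:] * Y)"
    unfolding L_def D_Y S_Y \<psi>n_eq power2_eq_square by (simp only: algebra_simps mult_1_left)
  then have 2: "uk n (\<phi>n n) + alpha q * (d (2 * n) * w2 + e n * w1) = 0"
    using uk_pearson [of n Y] by (simp only: uk_add uk_const_mult uk_A w1_def w2_def)
  have \<phi>w: "uk n (\<phi>n n) = a * w2 + b * w1 + c * w0"
    unfolding \<phi> uk_add uk_const_mult const w1_def w2_def ..
  have \<Phi>: "\<Phi> n * (d (2 * n))\<^sup>2 = a * (e n)\<^sup>2 - b * e n * d (2 * n) + c * (d (2 * n))\<^sup>2"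
    using assms(1) unfolding \<Phi>_def \<phi> by (simp add: Y_def field_simps power2_eq_square)
  have "uk (Suc n) 1 = - uk n (\<phi>n n)"
    unfolding uk_Suc' by simp
  moreover have "uk n (\<phi>n n) * d (Suc (2 * n)) * d (2 * n) = alpha q * w0 * (\<Phi> n * (d (2 * n))\<^sup>2)"
    using 1 2 unfolding d1 \<phi>w \<Phi> by algebra
  then have "d (2 * n) * (uk n (\<phi>n n) * d (Suc (2 * n))) = d (2 * n) * (alpha q * d (2 * n) * \<Phi> n * w0)"
    by (simp only: power2_eq_square mult_ac)
  then have "uk n (\<phi>n n) * d (Suc (2 * n)) = alpha q * d (2 * n) * \<Phi> n * w0"
    using assms(1) mult_left_cancel by blast
  ultimately show ?thesis
    by (simp add: w0_def)
qed

text \<open>As \<open>d m\<close> is nonzero, the functional equation on \<open>Y ^ m\<close>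
  determines the moment of order m + 1 from the lower ones; so \<open>u 1 = 0\<close> would make u
  zero.\<close>

lemma u_1_neq_0:
  assumes "\<And>n. d n \<noteq> 0"
  shows "u 1 \<noteq> 0"
proof
  assume u1: "u 1 = 0"
  have "f \<in> V (int n) \<Longrightarrow> u f = 0" for n f
  proof (induction n arbitrary: f)
    case 0
    then show ?case by (simp add: V_degree poly_dual_0 [OF u])
  next
    case (Suc n)
    have "u (Y ^ n) = 0"
    proof (cases n)
      case 0
      then show ?thesis using u1 by simp
    next
      case n: (Suc m)
      define t where "t = 0 * (an 0 * \<gamma> (m - 1) + d 0 * \<alpha> (m - 1)) + 1 * (bn 0 * \<gamma> m + e 0 * \<alpha> m)"
      have "L (\<phi>n 0) (\<psi>n 0) (Y ^ m) - [:1 * d (m + 0):] * Y ^ Suc m - [:t:] * Y ^ m \<in> V (int m)"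
        unfolding t_def dn_add [symmetric] \<phi>n_quadratic \<psi>n_eq mult_0_right
        by (rule L_lead) (simp_all flip: one_pCons)
      then have "L (\<phi>n 0) (\<psi>n 0) (Y ^ m) - [:1 * d (m + 0):] * Y ^ Suc m - [:t:] * Y ^ m + [:t:] * Y ^ m \<in> V (int n)"
        by (intro V_add V_const_mult power_Y_V) (auto elim: V_mono simp: n)
      then have "u (L (\<phi>n 0) (\<psi>n 0) (Y ^ m) - [:d m:] * Y ^ Suc m) = 0"
        using Suc.IH by simp
      then have "d m * u (Y ^ n) = 0"
        using uk_pearson [of 0 "Y ^ m"] unfolding poly_dual_diff [OF u] poly_dual_const_mult [OF u] n by simp
      then show ?thesis
        using assms by simp
    qed
    moreover obtain c where "f - [:c:] * Y ^ n \<in> V (int n)"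
      using Y_decomp [of f n] Suc.prems by (auto simp: add.commute)
    then have "u (f - [:c:] * Y ^ n) = 0"
      by (rule Suc.IH)
    ultimately show ?case
      unfolding poly_dual_diff [OF u] poly_dual_const_mult [OF u] by simp
  qed
  then have "u f = 0" for f
    using V_degree [of f "int (Suc (degree f))"] by fastforce
  then show False
    using u_neq_0 by auto
qed

text \<open>The coefficient of \<open>Y ^ (n - 1)\<close> in the monic orthogonal polynomial of degree \<open>n\<close>,
  and the value of \<open>u\<close> at its square.\<close>

definition t :: "nat \<Rightarrow> complex" where
  "t n = (if n = 0 then 0 else \<gamma> n * e (n - 1) / d (2 * n - 2))"

definition H :: "nat \<Rightarrow> complex" where
  "H n = kn q \<phi> \<psi> n * (- 1) ^ n * \<Gamma> n * uk n 1"

text \<open>In this indexing \<open>kn\<close> is visibly the inverse of the leading coefficient r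
  of \<open>iterated_rodrigues\<close> at k = 0. For n = 0 the truncated n - 1 sits in an empty
  product.\<close>

lemma kn_eq: "kn q \<phi> \<psi> n = inverse ((- alpha q) ^ n * (\<Prod>j<n. d (n - 1 + j)))"
proof -
  have "(\<Prod>j = 1..n. inverse (d (n + j - 2))) = (\<Prod>j<n. inverse (d (n + Suc j - 2)))"
    by (simp add: prod.atLeast1_atMost_eq)
  also have "\<dots> = (\<Prod>j<n. inverse (d (n - 1 + j)))"
    by (rule prod.cong) (auto intro!: arg_cong [of _ _ d])
  finally show ?thesis
    unfolding kn_def by (simp add: prod_inversef [unfolded comp_def])
qed

section \<open>The candidate polynomials when no d_n vanishes\<close>

context
  assumes d_neq_0: "\<And>n. d n \<noteq> 0"
begin

text \<open>The usual relation of C_(n+1) to the quotient of consecutive squared norms, stated as a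
  product because \<open>H n\<close> may still be 0.\<close>

lemma H_Suc: "H (Suc n) = recC q c1 c2 c3 \<phi> \<psi> (Suc n) * H n"
proof -
  define G where "G n = (\<Prod>j<n. d (n - 1 + j))" for n
  have G: "G n \<noteq> 0" for n
    by (simp add: G_def d_neq_0)
  have H: "H n = \<Gamma> n * uk n 1 / (alpha q ^ n * G n)" for n
    unfolding H_def kn_eq G_def [symmetric] by (simp add: power_minus [of "\<alpha> (Suc 0)"] field_simps)
  \<comment> \<open>\<open>G n\<close> is the product of d over the indices n - 1 to 2n - 2, and
    \<open>G (Suc n)\<close> over n to 2n, so all but three factors cancel. For n = 0 the value is
    1, which is the convention for d_(-1) / d_(-1).\<close>
  have ratio: "G n / G (Suc n) * d (2 * n) = (if n = 0 then 1 else d (n - 1) / d (2 * n - 1))"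
  proof (cases n)
    case 0
    then show ?thesis by (simp add: G_def d_neq_0)
  next
    case (Suc m)
    have "G n * d (2 * n - 1) * d (2 * n) = (\<Prod>j<Suc (Suc n). d (n - 1 + j))"
      by (simp add: G_def Suc mult_2)
    also have "\<dots> = d (n - 1) * G (Suc n)"
      unfolding prod.lessThan_Suc_shift [of _ "Suc n"] by (simp add: G_def Suc)
    finally show ?thesis
      using G d_neq_0 Suc by (simp add: field_simps)
  qed
  have w: "uk (Suc n) 1 = - alpha q * d (2 * n) * \<Phi> n * uk n 1 / d (Suc (2 * n))"
    using uk_1_Suc [of n] d_neq_0 by (simp add: field_simps)
  have "H (Suc n) = - (\<gamma> (Suc n) / d (Suc (2 * n)) * (G n / G (Suc n) * d (2 * n))) * \<Phi> n * H n"
    unfolding H w \<Gamma>_Suc using G alpha_neq_0 d_neq_0 by (simp add: field_simps)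
  then show ?thesis
    unfolding ratio by (simp add: \<Phi>_def)
qed

text \<open>Regularity is not assumed here, so both directions of the criterion can start from this
  family. Division by the nonzero r makes the polynomials of \<open>iterated_rodrigues\<close> monic
  and turns r' into \<open>t n\<close>.\<close>

lemma monic_family:
  obtains Q where "\<And>n f. u (f * Q n) = kn q \<phi> \<psi> n * (dual_Dx q c1 c2 c3 ^^ n) (uk n) f"
    and "\<And>n. Q n - Y ^ n - [:t n:] * Y ^ (n - 1) \<in> V (int n - 1)"
proof -
  have "\<exists>Q. (\<forall>f. u (f * Q) = kn q \<phi> \<psi> n * (dual_Dx q c1 c2 c3 ^^ n) (uk n) f) \<and>
    Q - Y ^ n - [:t n:] * Y ^ (n - 1) \<in> V (int n - 1)" for n
  proof -
    obtain X r r' where X: "\<And>f. (dual_Dx q c1 c2 c3 ^^ n) (uk (0 + n)) f = uk 0 (f * X)"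
      "X - [:r:] * Y ^ n - [:r':] * Y ^ (n - 1) \<in> V (int n - 1)"
      and r: "r = (- alpha q) ^ n * (\<Prod>j<n. d (2 * 0 + n - 1 + j))"
      and r': "n = 0 \<Longrightarrow> r' = 0" "n > 0 \<Longrightarrow> r' * d (2 * 0 + 2 * n - 2) = \<gamma> n * e (0 + n - 1) * r"
      using iterated_rodrigues [of n 0] by metis
    let ?k = "kn q \<phi> \<psi> n"
    have "r \<noteq> 0"
      using alpha_neq_0 d_neq_0 by (simp add: r)
    moreover have "?k = inverse r"
      by (simp add: kn_eq r)
    ultimately have k: "?k * r = 1"
      by simp
    have kr': "?k * r' = t n"
    proof (cases "n = 0")
      case False
      then have "r' = \<gamma> n * e (n - 1) * r / d (2 * n - 2)"
        using r'(2) d_neq_0 by (simp add: field_simps)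
      then have "?k * r' = (?k * r) * (\<gamma> n * e (n - 1) / d (2 * n - 2))"
        by simp
      then show ?thesis
        unfolding k using False by (simp add: t_def)
    qed (simp add: r' t_def)
    have "[:?k:] * (X - [:r:] * Y ^ n - [:r':] * Y ^ (n - 1)) = [:?k:] * X - [:?k * r:] * Y ^ n - [:?k * r':] * Y ^ (n - 1)"
      by (simp add: smult_diff_right)
    then have "[:?k:] * X - Y ^ n - [:t n:] * Y ^ (n - 1) \<in> V (int n - 1)"
      using V_const_mult(1) [OF X(2), of ?k] unfolding k kr' by (simp flip: one_pCons)
    moreover have "u (f * ([:?k:] * X)) = ?k * (dual_Dx q c1 c2 c3 ^^ n) (uk n) f" for f
      using X(1) [of f] poly_dual_smult [OF u, of ?k "f * X"] by simp
    ultimately show ?thesis by blast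
  qed
  then show ?thesis
    using that by metis
qed

text \<open>n-fold \<open>D\<close> sends \<open>f\<close> to a constant depending on its top
  coefficient c only. Thus c = 0 is the orthogonality and c = 1, with \<open>f\<close> the
  polynomial itself, the squared norm.\<close>

lemma u_Q:
  assumes "\<And>f. u (f * Q) = kn q \<phi> \<psi> n * (dual_Dx q c1 c2 c3 ^^ n) (uk n) f"
    and "f - [:c:] * Y ^ n \<in> V (int n)"
  shows "u (f * Q) = c * H n"
proof -
  have "uk n [:c * \<Gamma> n:] = c * \<Gamma> n * uk n 1"
    using uk_const_mult [of n "c * \<Gamma> n" 1] by simp
  then show ?thesis
    unfolding assms(1) dual_Dx_funpow D_funpow_lead [OF assms(2)] by (simp add: H_def)
qed

lemma lead_t:
  assumes "Q - Y ^ n - [:t n:] * Y ^ (n - 1) \<in> V (int n - 1)"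
  shows "Q - [:1:] * Y ^ n \<in> V (int n)"
proof -
  have "[:t n:] * Y ^ (n - 1) \<in> V (int n)"
    by (cases n) (simp add: t_def, intro V_const_mult power_Y_V, simp)
  then have "Q - Y ^ n - [:t n:] * Y ^ (n - 1) + [:t n:] * Y ^ (n - 1) \<in> V (int n)"
    by (intro V_add V_mono [OF assms]) simp_all
  then show ?thesis by (simp flip: one_pCons)
qed

lemma degree_lead:
  assumes "Q - [:1:] * Y ^ n \<in> V (int n)"
  shows "degree Q = n"
proof -
  have "Q - Y ^ n \<in> V (int n)"
    using assms by (simp flip: one_pCons)
  moreover have "degree (Y ^ n) = n"
    by (simp add: Y_def degree_linear_power)
  ultimately show ?thesis
    using degree_add_eq_right [of "Q - Y ^ n" "Y ^ n"] by (auto simp: V_degree)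
qed

lemma monic_lead:
  assumes "degree Q = n" "lead_coeff Q = 1"
  shows "Q - [:1:] * Y ^ n \<in> V (int n)"
proof -
  have "coeff (Y ^ n) n = 1" "degree (Y ^ n) = n"
    using lead_coeff_power [of Y n] by (simp_all add: Y_def degree_linear_power)
  then show ?thesis
    using assms by (auto simp: V_def coeff_eq_0 le_less)
qed

context
  fixes Q :: "nat \<Rightarrow> complex poly"
  assumes Q: "\<And>n f. u (f * Q n) = kn q \<phi> \<psi> n * (dual_Dx q c1 c2 c3 ^^ n) (uk n) f"
    and Q_lead: "\<And>n. Q n - Y ^ n - [:t n:] * Y ^ (n - 1) \<in> V (int n - 1)"
begin

lemma Q_lead': "Q n - [:1:] * Y ^ n \<in> V (int n)"
  by (rule lead_t [OF Q_lead])

lemma Q_orth: "f \<in> V (int n) \<Longrightarrow> u (f * Q n) = 0"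
  using u_Q [OF Q, of f 0 n] by simp

lemma degree_Q: "degree (Q n) = n"
  by (rule degree_lead [OF Q_lead'])

lemma is_OPS_Q:
  assumes "\<And>n. H n \<noteq> 0"
  shows "is_OPS u Q"
  unfolding is_OPS_def
proof (intro conjI allI exI [of _ H])
  fix n k
  have less: "u (Q i * Q j) = 0" if "i < j" for i j
    using that by (intro Q_orth) (simp add: V_degree degree_Q)
  show "u (Q n * Q k) = (if n = k then H n else 0)"
    using u_Q [OF Q Q_lead', of n] less [of n k] less [of k n] by (cases n k rule: linorder_cases) (simp_all add: mult.commute)
qed (use assms degree_Q in auto)

text \<open>Otherwise \<open>Q n\<close> would be orthogonal to all polynomials of degree at most n,
  hence zero, although it is monic.\<close>

lemma H_neq_0:
  assumes "regular u"
  shows "H n \<noteq> 0"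
proof
  assume H: "H n = 0"
  have "Q n = 0"
  proof (rule regular_nondegenerate [OF u assms])
    show "Q n \<in> V (int (Suc n))"
      by (simp add: V_degree degree_Q)
    fix g assume "g \<in> V (int (Suc n))"
    then obtain c where "g - [:c:] * Y ^ n \<in> V (int n)"
      using Y_decomp [of g n] by (auto simp: add.commute)
    then show "u (g * Q n) = 0"
      using u_Q [OF Q] H by simp
  qed
  with Q_lead' [of n] have "- ([:1:] * Y ^ n) \<in> V (int n)"
    by simp
  then have "0 - (- ([:1:] * Y ^ n)) \<in> V (int n)"
    by (intro V_diff V_0)
  then have "[:1:] * Y ^ n \<in> V (int n)"
    unfolding diff_0 minus_minus .
  then have "(1 :: complex) = 0"
    by (rule const_power_Y_in_V)
  then show False by simp
qed

lemma monic_OPS_eq_Q: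
  assumes "is_monic_OPS u P"
  shows "P n = Q n"
proof -
  have P: "is_OPS u P" "degree (P n) = n" "lead_coeff (P n) = 1"
    using assms by (auto simp: is_monic_OPS_def is_OPS_def)
  have "P n - Q n = 0"
  proof (rule regular_nondegenerate [OF u])
    show "regular u"
      using P(1) by (auto simp: regular_def)
    have "P n - [:1:] * Y ^ n - (Q n - [:1:] * Y ^ n) \<in> V (int n)"
      by (intro V_diff monic_lead P Q_lead')
    then show "P n - Q n \<in> V (int n)"
      by simp
    fix g assume "g \<in> V (int n)"
    then show "u (g * (P n - Q n)) = 0"
      using OPS_orth [OF u P(1)] Q_orth by (simp add: right_diff_distrib poly_dual_diff [OF u])
  qed
  then show ?thesis by simp
qed

text \<open>The defect \<open>W\<close> has degree below n, because \<open>\<beta>\<close> is the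
  difference of the second coefficients \<open>t n\<close> and \<open>t (Suc n)\<close>. It is
  orthogonal to all such degrees by \<open>H_Suc\<close>, hence 0. For n = 0 the only test
  polynomial is 0, so the arbitrary \<open>recC\<close> at 0 does not matter.\<close>

lemma Q_recurrence:
  assumes "regular u"
  shows "Q (Suc n) = [:- recB q c3 \<phi> \<psi> n, 1:] * Q n
    - smult (recC q c1 c2 c3 \<phi> \<psi> n) (if n = 0 then 0 else Q (n - 1))"
proof -
  define \<beta> C Q' where "\<beta> = recB q c3 \<phi> \<psi> n - c3" and "C = recC q c1 c2 c3 \<phi> \<psi> n"
    and "Q' = (if n = 0 then 0 else Q (n - 1))"
  have \<beta>: "\<beta> = t n - t (Suc n)"
    by (simp add: \<beta>_def recB_def t_def)
  have B: "[:- recB q c3 \<phi> \<psi> n, 1:] = Y - [:\<beta>:]"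
    by (simp add: \<beta>_def Y_def)
  define W where "W = Q (Suc n) - (Y * Q n - [:\<beta>:] * Q n - [:C:] * Q')"
  have "W = 0"
  proof (rule regular_nondegenerate [OF u assms])
    define E E' where "E = Q n - Y ^ n - [:t n:] * Y ^ (n - 1)"
      and "E' = Q (Suc n) - Y ^ Suc n - [:t (Suc n):] * Y ^ n"
    have E: "E \<in> V (int n - 1)" "E' \<in> V (int n)"
      using Q_lead [of n] Q_lead [of "Suc n"] by (simp_all add: E_def E'_def)
    have Q_eq: "Q n = Y ^ n + [:t n:] * Y ^ (n - 1) + E" "Q (Suc n) = Y * Y ^ n + [:t (Suc n):] * Y ^ n + E'"
      by (simp_all add: E_def E'_def)
    have tY: "[:t n:] * (Y * Y ^ (n - 1)) = [:t n:] * Y ^ n"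
      by (cases n) (simp_all add: t_def)
    have \<beta>': "[:\<beta>:] = [:t n:] - [:t (Suc n):]"
      by (simp add: \<beta>)
    have "W = E' - Y * E + [:\<beta>:] * ([:t n:] * Y ^ (n - 1) + E) + [:C:] * Q' + ([:t n:] * Y ^ n - [:t n:] * (Y * Y ^ (n - 1)))"
      unfolding W_def Q_eq \<beta>' by (simp only: algebra_simps)
    then have "W = E' - Y * E + [:\<beta>:] * ([:t n:] * Y ^ (n - 1) + E) + [:C:] * Q'"
      unfolding tY by simp
    moreover have "Y * E \<in> V (int n)"
      using V_mult [OF _ E(1), of Y 1] by (simp add: degree_Y)
    moreover have "[:t n:] * Y ^ (n - 1) \<in> V (int n)"
      by (cases n) (simp add: t_def, intro V_const_mult power_Y_V, simp)
    moreover have "Q' \<in> V (int n)"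
      by (simp add: Q'_def V_degree degree_Q)
    moreover have "E \<in> V (int n)"
      using E(1) by (rule V_mono) simp
    ultimately show "W \<in> V (int n)"
      using E(2) by (simp only: V_add V_diff V_const_mult)
  next
    fix g assume g: "g \<in> V (int n)"
    have "u (g * Q n) = 0" "u (g * Q (Suc n)) = 0"
      by (rule Q_orth [OF g], rule Q_orth, rule V_mono [OF g]) simp
    moreover have "u (g * Y * Q n) = C * u (g * Q')"
    proof (cases n)
      case 0
      with g have "g = 0"
        by (simp add: V_degree)
      then show ?thesis
        by (simp add: poly_dual_0 [OF u])
    next
      case (Suc m)
      then obtain c where c: "g - [:c:] * Y ^ m \<in> V (int m)"
        using Y_decomp [of g m] g by (auto simp: add.commute)
      have "Y * (g - [:c:] * Y ^ m) \<in> V (int n)"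
        using V_mult [OF _ c, of Y 1] by (simp add: degree_Y Suc add.commute)
      also have "Y * (g - [:c:] * Y ^ m) = g * Y - [:c:] * Y ^ n"
        by (simp only: Suc power_Suc algebra_simps)
      finally have "u (g * Y * Q n) = c * H n"
        by (rule u_Q [OF Q])
      moreover have "u (g * Q') = c * H m"
        using u_Q [OF Q c] by (simp add: Q'_def Suc)
      ultimately show ?thesis
        using H_Suc [of m] by (simp add: C_def Suc del: recC.simps)
    qed
    moreover have "g * W = g * Q (Suc n) - (g * Y * Q n - [:\<beta>:] * (g * Q n) - [:C:] * (g * Q'))"
      unfolding W_def by (simp only: algebra_simps)
    ultimately show "u (g * W) = 0"
      by (simp only: poly_dual_diff [OF u] poly_dual_const_mult [OF u]) simp
  qed
  then have "Q (Suc n) = (Y - [:\<beta>:]) * Q n - [:C:] * Q'"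
    unfolding W_def left_diff_distrib by simp
  then show ?thesis
    unfolding B C_def [symmetric] Q'_def [symmetric] by simp
qed

end

end

text \<open>By \<open>uk_1_Suc\<close> each step multiplies u^[n](1) by a nonzero multiple of
  \<open>\<Phi> n\<close>, and \<open>u_1_neq_0\<close> starts the chain.\<close>

lemma H_neq_0_iff: "(\<forall>n. H n \<noteq> 0) \<longleftrightarrow> (\<forall>n. \<Phi> n \<noteq> 0)" if d_neq_0: "\<And>n. d n \<noteq> 0"
proof -
  have kn: "kn q \<phi> \<psi> n \<noteq> 0" for n
    unfolding kn_eq using alpha_neq_0 d_neq_0 by simp
  have H: "H n = 0 \<longleftrightarrow> uk n 1 = 0" for n
    by (simp add: H_def kn \<Gamma>_neq_0)
  have Suc: "uk (Suc n) 1 = 0 \<longleftrightarrow> \<Phi> n = 0 \<or> uk n 1 = 0" for n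
    using uk_1_Suc [of n] d_neq_0 alpha_neq_0 by (metis minus_equation_iff minus_zero mult_eq_0_iff)
  show ?thesis
    unfolding H
  proof
    assume "\<forall>n. uk n 1 \<noteq> 0"
    then show "\<forall>n. \<Phi> n \<noteq> 0"
      using Suc by blast
  next
    assume *: "\<forall>n. \<Phi> n \<noteq> 0"
    have "uk n 1 \<noteq> 0" for n
    proof (induction n)
      case 0
      show ?case using u_1_neq_0 [OF d_neq_0] by simp
    next
      case (Suc n)
      then show ?case using * \<open>\<And>n. uk (Suc n) 1 = 0 \<longleftrightarrow> \<Phi> n = 0 \<or> uk n 1 = 0\<close> by blast
    qed
    then show "\<forall>n. uk n 1 \<noteq> 0" by blast
  qed
qed

section \<open>The regularity criterion and the explicit formulas\<close>

lemma regular_iff: "regular u \<longleftrightarrow> (\<forall>n. d n \<noteq> 0 \<and> \<Phi> n \<noteq> 0)"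
proof
  assume reg: "regular u"
  then have d: "d n \<noteq> 0" for n
    by (rule regular_dn_neq_0)
  obtain Q where Q: "\<And>n f. u (f * Q n) = kn q \<phi> \<psi> n * (dual_Dx q c1 c2 c3 ^^ n) (uk n) f"
    "\<And>n. Q n - Y ^ n - [:t n:] * Y ^ (n - 1) \<in> V (int n - 1)"
    using monic_family [OF d] by metis
  have "H n \<noteq> 0" for n
    by (rule H_neq_0 [OF d Q reg])
  then show "\<forall>n. d n \<noteq> 0 \<and> \<Phi> n \<noteq> 0"
    using d H_neq_0_iff [OF d] by blast
next
  assume *: "\<forall>n. d n \<noteq> 0 \<and> \<Phi> n \<noteq> 0"
  then have d: "d n \<noteq> 0" for n by blast
  obtain Q where Q: "\<And>n f. u (f * Q n) = kn q \<phi> \<psi> n * (dual_Dx q c1 c2 c3 ^^ n) (uk n) f"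
    "\<And>n. Q n - Y ^ n - [:t n:] * Y ^ (n - 1) \<in> V (int n - 1)"
    using monic_family [OF d] by metis
  have "H n \<noteq> 0" for n
    using H_neq_0_iff [OF d] * by blast
  then have "is_OPS u Q"
    by (rule is_OPS_Q [OF d Q])
  then show "regular u"
    by (auto simp: regular_def)
qed

lemma regular_iff_admissible:
  "regular u \<longleftrightarrow> x_admissible q \<phi> \<psi> \<and> (\<forall>n. \<not> \<psi>n n dvd \<phi>n n)"
  unfolding regular_iff x_admissible_iff using \<psi>n_dvd_iff by blast

lemma regular_monic_OPS:
  assumes "regular u" and "is_monic_OPS u P"
  shows "P (Suc n) = [:- recB q c3 \<phi> \<psi> n, 1:] * P n
      - smult (recC q c1 c2 c3 \<phi> \<psi> n) (if n = 0 then 0 else P (n - 1))"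
    and "u (f * P n) = kn q \<phi> \<psi> n * (dual_Dx q c1 c2 c3 ^^ n) (uk n) f"
proof -
  have d: "d n \<noteq> 0" for n
    by (rule regular_dn_neq_0 [OF assms(1)])
  obtain Q where Q: "\<And>n f. u (f * Q n) = kn q \<phi> \<psi> n * (dual_Dx q c1 c2 c3 ^^ n) (uk n) f"
    "\<And>n. Q n - Y ^ n - [:t n:] * Y ^ (n - 1) \<in> V (int n - 1)"
    using monic_family [OF d] by metis
  have P: "P n = Q n" for n
    by (rule monic_OPS_eq_Q [OF d Q assms(2)])
  show "P (Suc n) = [:- recB q c3 \<phi> \<psi> n, 1:] * P n
      - smult (recC q c1 c2 c3 \<phi> \<psi> n) (if n = 0 then 0 else P (n - 1))"
    unfolding P by (rule Q_recurrence [OF d Q assms(1)])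
  show "u (f * P n) = kn q \<phi> \<psi> n * (dual_Dx q c1 c2 c3 ^^ n) (uk n) f"
    unfolding P by (rule Q(1))
qed

end

theorem theorem4p1:
  fixes q :: real
    and c1 c2 c3 :: complex
    and u :: "complex poly \<Rightarrow> complex"
    and \<phi> \<psi> :: "complex poly"
  assumes "q > 0" and "q \<noteq> 1"
    and "(c1, c2) \<noteq> (0, 0)"
    and "u \<in> poly_dual" and "u \<noteq> (\<lambda>f. 0)"
    and "degree \<phi> \<le> 2" and "degree \<psi> \<le> 1" and "(\<phi>, \<psi>) \<noteq> (0, 0)"
    and "dual_Dx q c1 c2 c3 (lmult \<phi> u) = dual_Sx q c1 c2 c3 (lmult \<psi> u)"
  shows "(regular u \<longleftrightarrow>
            x_admissible q \<phi> \<psi> \<and> (\<forall>n. \<not> psin q c3 \<phi> \<psi> n dvd phin q c1 c2 c3 \<phi> \<psi> n))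
    \<and> (regular u \<longleftrightarrow>
            (\<forall>n. dn q \<phi> \<psi> n \<noteq> 0 \<and>
              poly (phin q c1 c2 c3 \<phi> \<psi> n) (c3 - en q c3 \<phi> \<psi> n / dn q \<phi> \<psi> (2 * n)) \<noteq> 0))
    \<and> (regular u \<longrightarrow> (\<forall>P. is_monic_OPS u P \<longrightarrow>
            (\<forall>n. P (n + 1) = [:- recB q c3 \<phi> \<psi> n, 1:] * P n
                   - smult (recC q c1 c2 c3 \<phi> \<psi> n) (if n = 0 then 0 else P (n - 1)))
          \<and> (\<forall>n. lmult (P n) u =
                   (\<lambda>f. kn q \<phi> \<psi> n *
                     (dual_Dx q c1 c2 c3 ^^ n) (un q c1 c2 c3 \<phi> \<psi> u n) f))))"
proof -
  interpret pearson q c1 c2 c3 u \<phi> \<psi>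
    by unfold_locales (use assms in auto)
  show ?thesis
    unfolding regular_iff_admissible [symmetric] lmult_def
    using regular_iff [unfolded \<Phi>_def] regular_monic_OPS
    by (intro conjI impI allI ext) (simp_all only: Suc_eq_plus1 [symmetric])
qed

end
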